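(* Let $D,m\ge 1$, let $0\neq w\in\mathrm{Sym}^D\mathbb{C}^m$ be a polystable form and $G=\mathrm{GL}_m$. Assume $b(w)<e(w)$. Then the vanishing ideal of the boundary $\overline{Gw}\setminus Gw$ in $\mathcal{O}(\overline{Gw})$ is strictly larger than the principal ideal $\Phi_w\mathcal{O}(\overline{Gw})$ generated by the fundamental invariant $\Phi_w$. Moreover, $\overline{Gw}$ is not a normal algebraic variety. In particular, $\mathcal{O}(\overline{Gw})$ is not a valuation ring.
   Context: Work over $\mathbb{C}$. $\mathrm{Sym}^D\mathbb{C}^m$ is the space of forms of degree $D$ in $m$ variables with the natural action of $G=\mathrm{GL}_m$. A form $w$ is polystable if its $\mathrm{SL}_m$-orbit is closed. $\mathrm{stab}(w)=\{g\in\mathrm{GL}_m\mid gw=w\}$; for nonzero polystable $w$ the group $\det(\mathrm{stab}(w))\subseteq\mathbb{C}^\times$ is finite, its order is the stabilizer period $a(w)$, and the degree period is the positive integer $b(w):=\frac{m}{D}a(w)$. $\overline{Gw}$ is the closure of the orbit, $\mathcal{O}(\overline{Gw})$ its coordinate ring, and $\mathcal{O}(\overline{Gw})^{\mathrm{SL}_m}_d$ the space of $\mathrm{SL}_m$-invariant functions in it homogeneous of degree $d$ (at most one-dimensional, and nonzero for some $d>0$). The minimal degree $e(w)$ is the smallest positive $d$ with $\mathcal{O}(\overline{Gw})^{\mathrm{SL}_m}_d\neq 0$; it is a multiple of $b(w)$ (the condition $b(w)<e(w)$ is thus equivalent to $e'(w):=e(w)/b(w)>1$). The fundamental invariant $\Phi_w$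 is the unique element of $\mathcal{O}(\overline{Gw})^{\mathrm{SL}_m}_{e(w)}$ with $\Phi_w(w)=1$. *)

theory Defs
  imports "HOL-Analysis.Analysis" "HOL-Algebra.Polynomials" "HOL-Algebra.Group_Action"
begin

section \<open>Field of fractions, integrality, valuation rings\<close>

text \<open>The field of fractions of a domain \<open>R\<close> is the quotient of the pairs \<open>(a, b)\<close> with
  \<open>b \<noteq> 0\<close> by \<open>(a, b) \<sim> (c, d) \<longleftrightarrow> a d = c b\<close>; \<open>fraction R a b\<close> is the class \<open>a / b\<close>.\<close>

definition fraction_pairs :: "('a, 'x) ring_scheme \<Rightarrow> ('a \<times> 'a) set" where
  "fraction_pairs R = carrier R \<times> (carrier R - {\<zero>\<^bsub>R\<^esub>})"

definition fraction_rel :: "('a, 'x) ring_scheme \<Rightarrow> (('a \<times> 'a) \<times> ('a \<times> 'a)) set" where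
  "fraction_rel R = {((a, b), (c, d)).
     (a, b) \<in> fraction_pairs R \<and> (c, d) \<in> fraction_pairs R \<and> a \<otimes>\<^bsub>R\<^esub> d = c \<otimes>\<^bsub>R\<^esub> b}"

definition fraction :: "('a, 'x) ring_scheme \<Rightarrow> 'a \<Rightarrow> 'a \<Rightarrow> ('a \<times> 'a) set" where
  "fraction R a b = fraction_rel R `` {(a, b)}"

definition fraction_field :: "('a, 'x) ring_scheme \<Rightarrow> ('a \<times> 'a) set ring" where
  "fraction_field R =
    \<lparr> carrier = fraction_pairs R // fraction_rel R,
      mult = (\<lambda>x y. \<Union>(a, b)\<in>x. \<Union>(c, d)\<in>y. fraction R (a \<otimes>\<^bsub>R\<^esub> c) (b \<otimes>\<^bsub>R\<^esub> d)),
      one = fraction R \<one>\<^bsub>R\<^esub> \<one>\<^bsub>R\<^esub>,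
      zero = fraction R \<zero>\<^bsub>R\<^esub> \<one>\<^bsub>R\<^esub>,
      add = (\<lambda>x y. \<Union>(a, b)\<in>x. \<Union>(c, d)\<in>y.
               fraction R ((a \<otimes>\<^bsub>R\<^esub> d) \<oplus>\<^bsub>R\<^esub> (c \<otimes>\<^bsub>R\<^esub> b)) (b \<otimes>\<^bsub>R\<^esub> d)) \<rparr>"

text \<open>Polynomials over a ring are lists of coefficients with the leading coefficient first, so
  \<open>\<one> # cs\<close> is monic.\<close>

definition integral_over :: "('a, 'x) ring_scheme \<Rightarrow> 'a set \<Rightarrow> 'a \<Rightarrow> bool" where
  "integral_over K A x \<longleftrightarrow> (\<exists>cs. set cs \<subseteq> A \<and> ring.eval K (\<one>\<^bsub>K\<^esub> # cs) x = \<zero>\<^bsub>K\<^esub>)"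

definition integrally_closed_in :: "('a, 'x) ring_scheme \<Rightarrow> 'a set \<Rightarrow> bool" where
  "integrally_closed_in K A \<longleftrightarrow> (\<forall>x\<in>carrier K. integral_over K A x \<longrightarrow> x \<in> A)"

definition valuation_ring :: "('a, 'x) ring_scheme \<Rightarrow> bool" where
  "valuation_ring R \<longleftrightarrow> domain R \<and>
    (let K = fraction_field R; A = (\<lambda>a. fraction R a \<one>\<^bsub>R\<^esub>) ` carrier R
     in \<forall>x \<in> carrier K - {\<zero>\<^bsub>K\<^esub>}. x \<in> A \<or> inv\<^bsub>K\<^esub> x \<in> A)"


section \<open>Forms and the action of the general linear group\<close>

text \<open>Over the complex numbers forms in \<open>m = CARD('m)\<close> variables are identified with the functions
  they define on \<open>\<complex>\<^sup>m\<close>; \<open>\<alpha>\<close> ranges over the exponent vectors of degree \<open>D\<close>.\<close>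

definition forms :: "nat \<Rightarrow> (complex ^ 'm \<Rightarrow> complex) set" where
  "forms D = {w. \<exists>c :: ('m \<Rightarrow> nat) \<Rightarrow> complex.
     w = (\<lambda>x. \<Sum>\<alpha> | (\<Sum>i\<in>UNIV. \<alpha> i) = D. c \<alpha> * (\<Prod>i\<in>UNIV. x $ i ^ \<alpha> i))}"

definition GL :: "(complex ^ 'm ^ 'm) monoid" where
  "GL = \<lparr> carrier = {g. invertible g}, mult = (**), one = mat 1 \<rparr>"

definition SL :: "(complex ^ 'm ^ 'm) monoid" where
  "SL = \<lparr> carrier = {g. det g = 1}, mult = (**), one = mat 1 \<rparr>"

text \<open>The algebra automorphism of the symmetric algebra of \<open>\<complex>\<^sup>m\<close> induced by \<open>g\<close> sends the
  variable \<open>x\<^sub>j\<close> to \<open>\<Sum>\<^sub>i g\<^sub>i\<^sub>j x\<^sub>i\<close>; on functions this is \<open>(g w)(x) = w(g\<^sup>T x)\<close>, a left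
  action in which the scalar matrix \<open>t I\<close> acts on forms of degree \<open>D\<close> as \<open>t\<^sup>D\<close>.\<close>

definition act :: "complex ^ 'm ^ 'm \<Rightarrow> (complex ^ 'm \<Rightarrow> complex) \<Rightarrow> (complex ^ 'm \<Rightarrow> complex)" where
  "act g w = (\<lambda>x. w (transpose g *v x))"


section \<open>Polynomial functions on the space of forms, closed sets and coordinate rings\<close>

definition linear_functional :: "nat \<Rightarrow> ((complex ^ 'm \<Rightarrow> complex) \<Rightarrow> complex) \<Rightarrow> bool" where
  "linear_functional D l \<longleftrightarrow>
     (\<forall>u\<in>forms D. \<forall>v\<in>forms D. l (\<lambda>x. u x + v x) = l u + l v) \<and>
     (\<forall>u\<in>forms D. \<forall>c. l (\<lambda>x. c * u x) = c * l u)"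

text \<open>The algebra of polynomial functions on a finite-dimensional vector space is generated by
  the linear functionals. Values outside \<open>forms D\<close> are irrelevant.\<close>

inductive_set poly_functions :: "nat \<Rightarrow> ((complex ^ 'm \<Rightarrow> complex) \<Rightarrow> complex) set" for D where
  const: "(\<lambda>_. c) \<in> poly_functions D"
| linear: "linear_functional D l \<Longrightarrow> l \<in> poly_functions D"
| add: "p \<in> poly_functions D \<Longrightarrow> q \<in> poly_functions D \<Longrightarrow> (\<lambda>v. p v + q v) \<in> poly_functions D"
| mult: "p \<in> poly_functions D \<Longrightarrow> q \<in> poly_functions D \<Longrightarrow> (\<lambda>v. p v * q v) \<in> poly_functions D"

text \<open>Closures are taken in the Zariski topology of the space of forms; for the orbits considered
  here they agree with the Euclidean ones.\<close>

definition zariski_closure ::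
  "nat \<Rightarrow> (complex ^ 'm \<Rightarrow> complex) set \<Rightarrow> (complex ^ 'm \<Rightarrow> complex) set" where
  "zariski_closure D S =
     {v \<in> forms D. \<forall>p\<in>poly_functions D. (\<forall>u\<in>S. p u = 0) \<longrightarrow> p v = 0}"

text \<open>Elements of the coordinate ring of a closed set \<open>Y\<close> are extensional functions: they
  are \<open>undefined\<close> outside \<open>Y\<close>.\<close>

definition coordinate_ring ::
  "nat \<Rightarrow> (complex ^ 'm \<Rightarrow> complex) set \<Rightarrow> ((complex ^ 'm \<Rightarrow> complex) \<Rightarrow> complex) ring" where
  "coordinate_ring D Y =
    \<lparr> carrier = (\<lambda>p. restrict p Y) ` poly_functions D,
      mult = (\<lambda>f g. \<lambda>v\<in>Y. f v * g v),
      one = (\<lambda>v\<in>Y. 1),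
      zero = (\<lambda>v\<in>Y. 0),
      add = (\<lambda>f g. \<lambda>v\<in>Y. f v + g v) \<rparr>"

definition vanishing_ideal ::
  "nat \<Rightarrow> (complex ^ 'm \<Rightarrow> complex) set \<Rightarrow> (complex ^ 'm \<Rightarrow> complex) set
     \<Rightarrow> ((complex ^ 'm \<Rightarrow> complex) \<Rightarrow> complex) set" where
  "vanishing_ideal D Y Z = {f \<in> carrier (coordinate_ring D Y). \<forall>v\<in>Z. f v = 0}"

text \<open>For irreducible \<open>Y\<close> (such as an orbit closure of \<open>GL\<close>) the local ring at \<open>v\<close> is the subring of the function field formed
  by the rational functions that are regular at \<open>v\<close>, and the function field is its field of
  fractions. \<open>Y\<close> is normal if all its local rings are integrally closed.\<close>

definition local_ring ::
  "nat \<Rightarrow> (complex ^ 'm \<Rightarrow> complex) set \<Rightarrow> (complex ^ 'm \<Rightarrow> complex)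
     \<Rightarrow> (((complex ^ 'm \<Rightarrow> complex) \<Rightarrow> complex) \<times> ((complex ^ 'm \<Rightarrow> complex) \<Rightarrow> complex)) set set" where
  "local_ring D Y v = {fraction (coordinate_ring D Y) f h | f h.
     f \<in> carrier (coordinate_ring D Y) \<and> h \<in> carrier (coordinate_ring D Y) \<and> h v \<noteq> 0}"

definition normal_variety :: "nat \<Rightarrow> (complex ^ 'm \<Rightarrow> complex) set \<Rightarrow> bool" where
  "normal_variety D Y \<longleftrightarrow>
     (\<forall>v\<in>Y. integrally_closed_in (fraction_field (coordinate_ring D Y)) (local_ring D Y v))"


section \<open>Polystable forms, their periods and fundamental invariants\<close>

definition polystable :: "nat \<Rightarrow> (complex ^ 'm \<Rightarrow> complex) \<Rightarrow> bool" where
  "polystable D w \<longleftrightarrow> zariski_closure D (orbit SL act w) = orbit SL act w"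

definition stabilizer_period :: "(complex ^ 'm \<Rightarrow> complex) \<Rightarrow> nat" where
  "stabilizer_period w = card (det ` stabilizer GL act w)"

definition degree_period :: "nat \<Rightarrow> (complex ^ 'm \<Rightarrow> complex) \<Rightarrow> real" where
  "degree_period D (w :: complex ^ 'm \<Rightarrow> complex) =
     real CARD('m) / real D * real (stabilizer_period w)"

definition orbit_closure ::
  "nat \<Rightarrow> (complex ^ 'm \<Rightarrow> complex) \<Rightarrow> (complex ^ 'm \<Rightarrow> complex) set" where
  "orbit_closure D w = zariski_closure D (orbit GL act w)"

definition SL_invariants ::
  "nat \<Rightarrow> (complex ^ 'm \<Rightarrow> complex) set \<Rightarrow> nat \<Rightarrow> ((complex ^ 'm \<Rightarrow> complex) \<Rightarrow> complex) set" where
  "SL_invariants D Y d = {f \<in> carrier (coordinate_ring D Y).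
     (\<forall>g\<in>carrier SL. \<forall>v\<in>Y. f (act g v) = f v) \<and>
     (\<forall>t. \<forall>v\<in>Y. f (\<lambda>x. t * v x) = t ^ d * f v)}"

text \<open>On natural numbers \<open>Inf\<close> is the minimum of a nonempty set.\<close>

definition minimal_degree :: "nat \<Rightarrow> (complex ^ 'm \<Rightarrow> complex) \<Rightarrow> nat" where
  "minimal_degree D w = Inf {d. d > 0 \<and>
     SL_invariants D (orbit_closure D w) d \<noteq> {\<zero>\<^bsub>coordinate_ring D (orbit_closure D w)\<^esub>}}"

definition fundamental_invariant ::
  "nat \<Rightarrow> (complex ^ 'm \<Rightarrow> complex) \<Rightarrow> ((complex ^ 'm \<Rightarrow> complex) \<Rightarrow> complex)" where
  "fundamental_invariant D w =
     (THE f. f \<in> SL_invariants D (orbit_closure D w) (minimal_degree D w) \<and> f w = 1)"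

end

theory Submission
  imports Defs
begin

text \<open>Write \<open>S\<close> for the \<open>SL\<^sub>m\<close>-orbit of \<open>w\<close>, \<open>Y\<close> for the closure of the \<open>GL\<^sub>m\<close>-orbit, \<open>e\<close> for the
  minimal degree and \<open>\<phi>\<close> for the fundamental invariant. Since \<open>D \<ge> 1\<close>, the \<open>GL\<^sub>m\<close>-orbit is the set of all
  \<open>c u\<close> with \<open>c \<noteq> 0\<close> and \<open>u \<in> S\<close>, and \<open>\<phi>(c u) = c\<^sup>e\<close>. The scalars \<open>z\<close> with \<open>z w \<in> S\<close> form a
  finite group \<open>\<mu>\<close>; counting the \<open>t\<close> with \<open>t\<^sup>D \<in> \<mu>\<close> in two ways shows that its order \<open>n\<close> is the degree
  period, and \<open>n\<close> divides \<open>e\<close>. So the function \<open>c u \<mapsto> c\<^sup>n\<close> is well defined on the orbit. It is a root of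
  \<open>\<phi>\<close> of order \<open>e / n\<close>, which is at least \<open>2\<close> by hypothesis, but no polynomial function induces it,
  because it would be an invariant of degree \<open>n < e\<close>.

  This function is nevertheless rational on \<open>Y\<close>: there are polynomial functions \<open>A\<close>, \<open>B\<close> with
  \<open>A(c u) = c\<^sup>n B(c u)\<close> and \<open>B(w) \<noteq> 0\<close> (\<open>exists_rational_semi_invariant\<close>). They come from a polynomial function
  that vanishes at all \<open>z u\<close> with \<open>z\<^sup>e = 1\<close> and \<open>z \<notin> \<mu>\<close> but not at \<open>w\<close>; it exists because \<open>S\<close> is closed. Its
  values on the \<open>e\<close>-th roots of unity are supported on \<open>\<mu>\<close>, so its graded parts modulo \<open>e\<close> agree on \<open>S\<close> when
  shifted by \<open>n\<close>; powers of \<open>\<phi>\<close> make these parts homogeneous.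

  Everything follows from \<open>A\<^bsup>e/n\<^esup> = \<phi> B\<^bsup>e/n\<^esup>\<close>. The quotient \<open>A / B\<close> is integral over the coordinate ring, but it is
  not regular at the origin (\<open>denominator_vanishes_at_0\<close>), so \<open>Y\<close> is not normal. Neither \<open>A / B\<close> nor
  \<open>B / A\<close> lies in the coordinate ring, which is therefore not a valuation ring. Homogenization
  by powers of \<open>\<phi>\<close> also shows that the boundary is the zero set of \<open>\<phi>\<close> in \<open>Y\<close> (\<open>boundary_iff\<close>). If \<open>\<phi>\<close> generated its
  vanishing ideal, then \<open>A\<close> and afterwards \<open>B\<close> would be divisible by \<open>\<phi>\<close>, the quotients would satisfy
  the same relation, and the degree of \<open>B\<close> would decrease forever (\<open>infinite_descent_by_\<phi>\<close>).

  The existence of a nonconstant homogeneous invariant, on which \<open>e\<close> and \<open>\<phi>\<close> rest, needs complete reducibility in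
  some form. Here it enters through a linear functional on the homogeneous polynomials on
  matrices, invariant under right translation by \<open>SL\<^sub>m\<close> and nonzero on a power of the determinant
  (\<open>invariant_functional\<close>). Applied to \<open>g \<mapsto> q(g v)\<close> it turns a polynomial function \<open>q\<close> into an
  invariant one, as Cayley's Omega process does (\<open>invariant_of_separation\<close>).\<close>

section \<open>Fields of fractions\<close>

context domain
begin

lemma fraction_pairs_iff [simp]:
  "(a, b) \<in> fraction_pairs R \<longleftrightarrow> a \<in> carrier R \<and> b \<in> carrier R \<and> b \<noteq> \<zero>"
  by (auto simp: fraction_pairs_def)

lemma fraction_rel_trans:
  assumes "((a, b), (c, d)) \<in> fraction_rel R" "((c, d), (g, h)) \<in> fraction_rel R"
  shows "((a, b), (g, h)) \<in> fraction_rel R"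
proof -
  have c: "a \<in> carrier R" "b \<in> carrier R" "c \<in> carrier R" "d \<in> carrier R" "g \<in> carrier R" "h \<in> carrier R"
    "b \<noteq> \<zero>" "d \<noteq> \<zero>" "h \<noteq> \<zero>"
    and e1: "a \<otimes> d = c \<otimes> b" and e2: "c \<otimes> h = g \<otimes> d"
    using assms by (auto simp: fraction_rel_def)
  have "d \<otimes> (a \<otimes> h) = (a \<otimes> d) \<otimes> h" using c by (simp add: m_ac)
  also have "\<dots> = (c \<otimes> h) \<otimes> b" using c by (simp add: e1 m_ac)
  also have "\<dots> = d \<otimes> (g \<otimes> b)" using c by (simp add: e2 m_ac)
  finally have "a \<otimes> h = g \<otimes> b" using c m_lcancel by simp
  then show ?thesis using c by (simp add: fraction_rel_def)
qed

lemma equiv_fraction_rel: "equiv (fraction_pairs R) (fraction_rel R)"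
proof (rule equivI)
  show "fraction_rel R \<subseteq> fraction_pairs R \<times> fraction_pairs R" by (auto simp: fraction_rel_def)
  show "refl_on (fraction_pairs R) (fraction_rel R)"
    by (auto simp: fraction_rel_def refl_on_def)
  show "sym (fraction_rel R)" by (auto simp: fraction_rel_def sym_def)
  show "trans (fraction_rel R)" unfolding trans_def using fraction_rel_trans by fast
qed

lemma fraction_eq_iff:
  assumes "a \<in> carrier R" "b \<in> carrier R - {\<zero>}" "c \<in> carrier R" "d \<in> carrier R - {\<zero>}"
  shows "fraction R a b = fraction R c d \<longleftrightarrow> a \<otimes> d = c \<otimes> b"
  using eq_equiv_class_iff[OF equiv_fraction_rel, of "(a, b)" "(c, d)"] assms
  by (simp add: fraction_def fraction_rel_def)

lemma mem_fraction_iff: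
  "(c, d) \<in> fraction R a b \<longleftrightarrow> ((a, b), (c, d)) \<in> fraction_rel R"
  by (simp add: fraction_def)

lemma carrier_fraction_field:
  "carrier (fraction_field R) = {fraction R a b | a b. a \<in> carrier R \<and> b \<in> carrier R - {\<zero>}}"
  by (auto simp: fraction_field_def quotient_def fraction_def fraction_pairs_def)

lemma UN_fraction_const:
  assumes "(a, b) \<in> fraction_pairs R" and "\<And>c d. (c, d) \<in> fraction R a b \<Longrightarrow> f c d = x"
  shows "(\<Union>(c, d)\<in>fraction R a b. f c d) = x"
proof -
  have "(a, b) \<in> fraction R a b" using assms(1) by (simp add: mem_fraction_iff fraction_rel_def)
  then show ?thesis using assms(2) by fastforce
qed

lemma fraction_mult:
  assumes "a \<in> carrier R" "b \<in> carrier R - {\<zero>}" "c \<in> carrier R" "d \<in> carrier R - {\<zero>}"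
  shows "fraction R a b \<otimes>\<^bsub>fraction_field R\<^esub> fraction R c d = fraction R (a \<otimes> c) (b \<otimes> d)"
proof -
  have "fraction R (a' \<otimes> c') (b' \<otimes> d') = fraction R (a \<otimes> c) (b \<otimes> d)"
    if "(a', b') \<in> fraction R a b" "(c', d') \<in> fraction R c d" for a' b' c' d'
  proof -
    have c: "a' \<in> carrier R" "b' \<in> carrier R" "c' \<in> carrier R" "d' \<in> carrier R" "b' \<noteq> \<zero>" "d' \<noteq> \<zero>"
      and e1: "a \<otimes> b' = a' \<otimes> b" and e2: "c \<otimes> d' = c' \<otimes> d"
      using that by (auto simp: mem_fraction_iff fraction_rel_def)
    have "(a' \<otimes> c') \<otimes> (b \<otimes> d) = (a' \<otimes> b) \<otimes> (c' \<otimes> d)" using c assms by (simp add: m_ac)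
    also have "\<dots> = (a \<otimes> b') \<otimes> (c \<otimes> d')" by (simp add: e1 e2)
    also have "\<dots> = (a \<otimes> c) \<otimes> (b' \<otimes> d')" using c assms by (simp add: m_ac)
    finally show ?thesis using c assms integral_iff by (subst fraction_eq_iff) auto
  qed
  then show ?thesis using assms
    unfolding fraction_field_def by (simp add: UN_fraction_const)
qed

lemma fraction_add:
  assumes "a \<in> carrier R" "b \<in> carrier R - {\<zero>}" "c \<in> carrier R" "d \<in> carrier R - {\<zero>}"
  shows "fraction R a b \<oplus>\<^bsub>fraction_field R\<^esub> fraction R c d
           = fraction R ((a \<otimes> d) \<oplus> (c \<otimes> b)) (b \<otimes> d)"
proof -
  have "fraction R ((a' \<otimes> d') \<oplus> (c' \<otimes> b')) (b' \<otimes> d') = fraction R ((a \<otimes> d) \<oplus> (c \<otimes> b)) (b \<otimes> d)"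
    if "(a', b') \<in> fraction R a b" "(c', d') \<in> fraction R c d" for a' b' c' d'
  proof -
    have c: "a' \<in> carrier R" "b' \<in> carrier R" "c' \<in> carrier R" "d' \<in> carrier R" "b' \<noteq> \<zero>" "d' \<noteq> \<zero>"
      and e1: "a \<otimes> b' = a' \<otimes> b" and e2: "c \<otimes> d' = c' \<otimes> d"
      using that by (auto simp: mem_fraction_iff fraction_rel_def)
    have "((a' \<otimes> d') \<oplus> (c' \<otimes> b')) \<otimes> (b \<otimes> d)
            = ((a' \<otimes> b) \<otimes> (d \<otimes> d')) \<oplus> ((c' \<otimes> d) \<otimes> (b \<otimes> b'))"
      using c assms by (simp add: l_distr r_distr m_ac)
    also have "\<dots> = ((a \<otimes> b') \<otimes> (d \<otimes> d')) \<oplus> ((c \<otimes> d') \<otimes> (b \<otimes> b'))" by (simp add: e1 e2)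
    also have "\<dots> = ((a \<otimes> d) \<oplus> (c \<otimes> b)) \<otimes> (b' \<otimes> d')" using c assms by (simp add: l_distr r_distr m_ac)
    finally show ?thesis using c assms integral_iff by (subst fraction_eq_iff) auto
  qed
  then show ?thesis using assms
    unfolding fraction_field_def by (simp add: UN_fraction_const)
qed

lemma zero_fraction_field: "\<zero>\<^bsub>fraction_field R\<^esub> = fraction R \<zero> \<one>"
  and one_fraction_field: "\<one>\<^bsub>fraction_field R\<^esub> = fraction R \<one> \<one>"
  by (simp_all add: fraction_field_def)

lemma fraction_in_carrier:
  "a \<in> carrier R \<Longrightarrow> b \<in> carrier R - {\<zero>} \<Longrightarrow> fraction R a b \<in> carrier (fraction_field R)"
  by (auto simp: carrier_fraction_field)

lemma fraction_cases:
  assumes "x \<in> carrier (fraction_field R)"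
  obtains a b where "a \<in> carrier R" "b \<in> carrier R" "b \<noteq> \<zero>" "x = fraction R a b"
  using assms by (auto simp: carrier_fraction_field)

lemma cring_fraction_field: "cring (fraction_field R)"
proof (rule cringI)
  show "abelian_group (fraction_field R)"
  proof (rule abelian_groupI, goal_cases)
    case (6 x)
    then obtain a b where ab: "a \<in> carrier R" "b \<in> carrier R - {\<zero>}" "x = fraction R a b"
      by (auto simp: carrier_fraction_field)
    then have "fraction R (\<ominus> a) b \<oplus>\<^bsub>fraction_field R\<^esub> x = \<zero>\<^bsub>fraction_field R\<^esub>"
      using integral_iff by (simp add: fraction_add zero_fraction_field fraction_eq_iff l_minus l_neg)
    then show ?case using ab fraction_in_carrier[of "\<ominus> a" b] by blast
  next
    case (1 x y)
    then show ?case
      by (auto elim!: fraction_cases intro!: fraction_in_carrier simp: fraction_add integral_iff)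
  next
    case 2
    show ?case by (auto intro: fraction_in_carrier simp: zero_fraction_field)
  qed (auto elim!: fraction_cases simp: fraction_add zero_fraction_field fraction_eq_iff
         integral_iff l_distr r_distr m_ac a_ac)
  show "comm_monoid (fraction_field R)"
  proof (rule comm_monoidI, goal_cases)
    case (1 x y)
    then show ?case
      by (auto elim!: fraction_cases intro!: fraction_in_carrier simp: fraction_mult integral_iff)
  next
    case 2
    show ?case by (auto intro: fraction_in_carrier simp: one_fraction_field)
  qed (auto elim!: fraction_cases simp: fraction_mult one_fraction_field fraction_eq_iff
         integral_iff m_ac)
next
  fix x y z
  assume "x \<in> carrier (fraction_field R)" "y \<in> carrier (fraction_field R)"
    "z \<in> carrier (fraction_field R)"
  then show "(x \<oplus>\<^bsub>fraction_field R\<^esub> y) \<otimes>\<^bsub>fraction_field R\<^esub> z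
      = x \<otimes>\<^bsub>fraction_field R\<^esub> z \<oplus>\<^bsub>fraction_field R\<^esub> y \<otimes>\<^bsub>fraction_field R\<^esub> z"
    by (elim fraction_cases, simp add: fraction_mult fraction_add integral_iff)
       (subst fraction_eq_iff, auto simp: integral_iff l_distr r_distr m_ac)
qed

lemma fraction_pow:
  assumes "a \<in> carrier R" "b \<in> carrier R - {\<zero>}"
  shows "fraction R a b [^]\<^bsub>fraction_field R\<^esub> (n :: nat) = fraction R (a [^] n) (b [^] n)"
proof (induction n)
  case 0
  then show ?case by (simp add: one_fraction_field)
next
  case (Suc n)
  have "b [^] n \<noteq> \<zero>" using assms by (induction n) (auto simp: integral_iff)
  then show ?case using Suc assms by (simp add: fraction_mult)
qed

text \<open>The monic equation is \<open>X\<^sup>n - c = 0\<close>.\<close>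

lemma integral_over_root:
  assumes a: "a \<in> carrier R" and b: "b \<in> carrier R - {\<zero>}" and c: "c \<in> carrier R"
    and n: "(n :: nat) \<ge> 1" and root: "a [^] n = c \<otimes> b [^] n"
    and A: "\<And>r. r \<in> carrier R \<Longrightarrow> fraction R r \<one> \<in> A"
  shows "integral_over (fraction_field R) A (fraction R a b)"
proof -
  let ?K = "fraction_field R"
  interpret K: cring ?K by (rule cring_fraction_field)
  obtain k where k: "n = Suc k" using n by (cases n) auto
  let ?x = "fraction R a b" and ?c = "fraction R (\<ominus> c) \<one>"
  let ?cs = "replicate k \<zero>\<^bsub>?K\<^esub> @ [?c]"
  have x: "?x \<in> carrier ?K" and c': "?c \<in> carrier ?K"
    using a b c by (auto intro: fraction_in_carrier)
  have bn: "b [^] n \<in> carrier R - {\<zero>}" for n :: nat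
    using b by (induction n) (auto simp: integral_iff)
  have "K.eval (\<one>\<^bsub>?K\<^esub> # ?cs) ?x = ?x [^]\<^bsub>?K\<^esub> n \<oplus>\<^bsub>?K\<^esub> ?c"
    using x c' by (simp add: K.eval_replicate k)
  also have "\<dots> = \<zero>\<^bsub>?K\<^esub>"
    using a b c bn[of n] by (simp add: fraction_pow fraction_add zero_fraction_field fraction_eq_iff
      root l_minus r_neg)
  finally have "K.eval (\<one>\<^bsub>?K\<^esub> # ?cs) ?x = \<zero>\<^bsub>?K\<^esub>" .
  moreover have "set ?cs \<subseteq> A"
    using A[of \<zero>] A[of "\<ominus> c"] c by (auto simp: zero_fraction_field)
  ultimately show ?thesis unfolding integral_over_def by blast
qed

lemma inv_fraction:
  assumes "a \<in> carrier R - {\<zero>}" "b \<in> carrier R - {\<zero>}"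
  shows "inv\<^bsub>fraction_field R\<^esub> (fraction R a b) = fraction R b a"
proof -
  interpret K: cring "fraction_field R" by (rule cring_fraction_field)
  show ?thesis
    using assms integral_iff
    by (intro K.inv_unique'[symmetric])
       (auto simp: fraction_in_carrier fraction_mult one_fraction_field fraction_eq_iff m_ac)
qed

end


section \<open>Roots of unity\<close>

lemma sum_powers_roots_of_unity:
  assumes N: "N > 0"
  shows "(\<Sum>z | z ^ N = 1. z ^ k) = (if N dvd k then of_nat N else (0 :: complex))"
proof (cases "N dvd k")
  case True
  then have "z ^ k = 1" if "z ^ N = 1" for z :: complex
    using that by (auto simp: dvd_def power_mult)
  then have "(\<Sum>z | z ^ N = 1. z ^ k) = (\<Sum>z | z ^ N = (1::complex). (1::complex))"
    by (intro sum.cong) auto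
  then show ?thesis using True card_nth_roots[of 1 N] N by simp
next
  case False
  define \<omega> where "\<omega> = cis (2 * pi / N)"
  have \<omega>N: "\<omega> ^ N = 1" using N by (simp add: \<omega>_def Complex.DeMoivre)
  have \<omega>k: "\<omega> ^ k \<noteq> 1"
  proof
    assume "\<omega> ^ k = 1"
    then have "cis (real k * (2 * pi / N)) = 1" by (simp only: \<omega>_def Complex.DeMoivre)
    then have "exp (2 * of_real pi * \<i> * of_nat k / of_nat N) = (1 :: complex)"
      by (simp add: cis_conv_exp field_simps)
    then show False using False N complex_root_unity_eq_1[of N k] by simp
  qed
  let ?S = "\<Sum>z | z ^ N = 1. z ^ k :: complex"
  have "\<omega> \<noteq> 0" by (simp add: \<omega>_def)
  then have "bij_betw ((*) \<omega>) {z. z ^ N = 1} {z. z ^ N = 1}"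
    using \<omega>N by (intro bij_betwI[where g = "\<lambda>z. z / \<omega>"]) (auto simp: power_mult_distrib power_divide)
  then have "?S = (\<Sum>z | z ^ N = 1. (\<omega> * z) ^ k)"
    using sum.reindex_bij_betw[of "(*) \<omega>" _ _ "\<lambda>z. z ^ k"] by simp
  also have "\<dots> = \<omega> ^ k * ?S" by (simp add: power_mult_distrib sum_distrib_left)
  finally have "?S = 0" using \<omega>k by (simp add: algebra_simps)
  then show ?thesis using False by simp
qed

text \<open>Averaging against a character of the group of \<open>N\<close>-th roots of unity picks out one
  coefficient of a polynomial of degree less than \<open>N\<close>.\<close>

lemma extract_coefficient:
  fixes c :: "nat \<Rightarrow> complex"
  assumes "b < N"
  shows "(\<Sum>z | z ^ N = 1. z ^ (N - b) * (\<Sum>k<N. z ^ k * c k)) = of_nat N * c b"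
proof -
  have eq: "N dvd N + k - b \<longleftrightarrow> k = b" if "k < N" for k
  proof
    assume "N dvd N + k - b"
    then obtain q where q: "N + k - b = N * q" by (auto simp: dvd_def)
    have "0 < N * q" "N * q < 2 * N" using q assms that by linarith+
    then have "q = 1" by (cases q) auto
    then show "k = b" using q assms by simp
  qed (use assms in auto)
  have "(\<Sum>z | z ^ N = 1. z ^ (N - b) * (\<Sum>k<N. z ^ k * c k))
      = (\<Sum>z | z ^ N = 1. \<Sum>k<N. z ^ (N - b + k) * c k)"
    by (simp add: sum_distrib_left power_add mult_ac)
  also have "\<dots> = (\<Sum>k<N. c k * (\<Sum>z | z ^ N = 1. z ^ (N - b + k)))"
    by (subst sum.swap) (simp add: sum_distrib_left mult_ac)
  also have "\<dots> = (\<Sum>k<N. if k = b then of_nat N * c b else 0)"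
    using assms by (intro sum.cong) (auto simp: sum_powers_roots_of_unity eq)
  finally show ?thesis using assms by simp
qed

lemma coefficients_eq_0:
  fixes c :: "nat \<Rightarrow> complex"
  assumes "\<And>z. z ^ N = 1 \<Longrightarrow> (\<Sum>k<N. z ^ k * c k) = 0" and "b < N"
  shows "c b = 0"
  using extract_coefficient[of b N c] assms by simp


section \<open>Homogeneous polynomial functions on matrices\<close>

definition entry_pairing :: "complex ^ 'm ^ 'm \<Rightarrow> complex ^ 'm ^ 'm \<Rightarrow> complex" where
  "entry_pairing Y T = (\<Sum>i\<in>UNIV. \<Sum>j\<in>UNIV. Y $ i $ j * T $ i $ j)"

text \<open>The point with parameter \<open>s\<close> of the line through \<open>A\<close> in direction \<open>B\<close>; the scalar \<open>s\<close> is complex.\<close>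

definition line_point ::
  "complex ^ 'm ^ 'm \<Rightarrow> complex ^ 'm ^ 'm \<Rightarrow> complex \<Rightarrow> complex ^ 'm ^ 'm" where
  "line_point A B s = (\<chi> i j. A $ i $ j + s * B $ i $ j)"

lemma entry_pairing_line_right:
  "entry_pairing Y (line_point A B s) = entry_pairing Y A + s * entry_pairing Y B"
  and entry_pairing_line_left:
  "entry_pairing (line_point A B s) T = entry_pairing A T + s * entry_pairing B T"
  by (simp_all add: entry_pairing_def line_point_def algebra_simps sum.distrib sum_distrib_left)

text \<open>The span of the \<open>d\<close>-th powers of linear forms is the space of all homogeneous polynomials of degree \<open>d\<close> on
  matrices. In this form a polynomial is a combination of kernels \<open>\<langle>Y, T\<rangle>\<^sup>d\<close>, for which a translation
  of \<open>T\<close> can be moved to \<open>Y\<close>; \<open>invariant_functional\<close> depends on this.\<close>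

inductive_set power_span :: "nat \<Rightarrow> (complex ^ 'm ^ 'm \<Rightarrow> complex) set" for d where
  power: "(\<lambda>T. entry_pairing Y T ^ d) \<in> power_span d"
| add: "F \<in> power_span d \<Longrightarrow> G \<in> power_span d \<Longrightarrow> (\<lambda>T. F T + G T) \<in> power_span d"
| scale: "F \<in> power_span d \<Longrightarrow> (\<lambda>T. c * F T) \<in> power_span d"

lemma power_span_zero: "(\<lambda>T. 0) \<in> power_span d"
  using power_span.scale[OF power_span.power, of 0] by simp

lemma power_span_sum:
  "(\<And>a. a \<in> A \<Longrightarrow> F a \<in> power_span d) \<Longrightarrow> (\<lambda>T. \<Sum>a\<in>A. F a T) \<in> power_span d"
  by (induction A rule: infinite_finite_induct) (auto intro: power_span_zero power_span.add)

lemma power_span_const: "(\<lambda>T. c) \<in> power_span 0"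
  using power_span.scale[OF power_span.power, of c _ 0] by simp

lemma power_span_entry:
  fixes i j :: "'m :: finite"
  shows "(\<lambda>T :: complex ^ 'm ^ 'm. T $ i $ j) \<in> power_span 1"
proof -
  have "entry_pairing (\<chi> k l. if k = i \<and> l = j then 1 else 0) T = T $ i $ j"
    for T :: "complex ^ 'm ^ 'm"
  proof -
    have "entry_pairing (\<chi> k l. if k = i \<and> l = j then 1 else 0) T
        = (\<Sum>k\<in>UNIV. if k = i then \<Sum>l\<in>UNIV. if l = j then T $ k $ l else 0 else 0)"
      unfolding entry_pairing_def by (intro sum.cong refl) (auto simp: if_distrib[of "\<lambda>x. x * _"] cong: if_cong)
    also have "\<dots> = T $ i $ j" by simp
    finally show ?thesis .
  qed
  then show ?thesis
    using power_span.power[of "\<chi> k l. if k = i \<and> l = j then 1 else 0" 1] by simp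
qed

text \<open>Polarization: the product is, up to a nonzero factor, the coefficient of \<open>z\<^sup>b\<close> in \<open>\<langle>Y + z Z, T\<rangle>\<^bsup>a+b\<^esup>\<close>, and a
  coefficient is a combination of the values at roots of unity.\<close>

lemma power_span_mult_powers:
  "(\<lambda>T. entry_pairing Y T ^ a * entry_pairing Z T ^ b) \<in> power_span (a + b)"
proof -
  define N where "N = Suc (a + b)"
  define K where "K = (of_nat N * of_nat (a + b choose b) :: complex)"
  have K: "K \<noteq> 0" unfolding K_def N_def by (simp del: of_nat_Suc)
  have "(\<Sum>z | z ^ N = 1. z ^ (N - b) * entry_pairing (line_point Y Z z) T ^ (a + b))
      = K * (entry_pairing Y T ^ a * entry_pairing Z T ^ b)" for T
  proof -
    have "entry_pairing (line_point Y Z z) T ^ (a + b)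
        = (\<Sum>k<N. z ^ k *
            (of_nat (a + b choose k) * entry_pairing Z T ^ k * entry_pairing Y T ^ (a + b - k)))" for z
      unfolding entry_pairing_line_left N_def
      by (subst add.commute, subst binomial_ring)
         (simp add: lessThan_Suc_atMost power_mult_distrib mult_ac)
    moreover have "b < N" by (simp add: N_def)
    ultimately show ?thesis
      unfolding K_def by (simp only: extract_coefficient) (simp add: mult_ac)
  qed
  moreover have "(\<lambda>T. inverse K * (\<Sum>z | z ^ N = 1. z ^ (N - b) *
      entry_pairing (line_point Y Z z) T ^ (a + b))) \<in> power_span (a + b)"
    by (intro power_span.scale power_span_sum power_span.power)
  ultimately show ?thesis using K by (simp add: mult.assoc[symmetric])
qed

lemma power_span_mult:
  assumes "F \<in> power_span a" "G \<in> power_span b"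
  shows "(\<lambda>T. F T * G T) \<in> power_span (a + b)"
  using assms(1)
proof induction
  case (power Y)
  show ?case using assms(2)
  proof induction
    case (power Z)
    show ?case by (rule power_span_mult_powers)
  next
    case (add G H)
    then show ?case using power_span.add[OF add.IH] by (simp add: algebra_simps)
  next
    case (scale G c)
    then show ?case using power_span.scale[OF scale.IH, of c] by (simp add: mult_ac)
  qed
next
  case (add F H)
  then show ?case using power_span.add[OF add.IH] by (simp add: algebra_simps)
next
  case (scale F c)
  then show ?case using power_span.scale[OF scale.IH, of c] by (simp add: mult_ac)
qed

lemma power_span_prod:
  assumes "finite A" "\<And>a. a \<in> A \<Longrightarrow> F a \<in> power_span (d a)"
  shows "(\<lambda>T. \<Prod>a\<in>A. F a T) \<in> power_span (sum d A)"
  using assms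
  by (induction A rule: finite_induct) (auto intro: power_span_const power_span_mult)

lemma power_span_power: "F \<in> power_span d \<Longrightarrow> (\<lambda>T. F T ^ n) \<in> power_span (d * n)"
  by (induction n) (auto intro: power_span_const power_span_mult)

lemma power_span_det: "(det :: complex ^ 'm ^ 'm \<Rightarrow> complex) \<in> power_span CARD('m)"
proof -
  have "(\<lambda>T :: complex ^ 'm ^ 'm. \<Prod>i\<in>UNIV. T $ i $ p i) \<in> power_span CARD('m)" for p :: "'m \<Rightarrow> 'm"
    using power_span_prod[of UNIV "\<lambda>i T. T $ i $ p i" "\<lambda>_. 1"]
    by (simp add: power_span_entry[simplified])
  then have "(\<lambda>T :: complex ^ 'm ^ 'm. \<Sum>p | p permutes UNIV. of_int (sign p) * (\<Prod>i\<in>UNIV. T $ i $ p i))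
      \<in> power_span CARD('m)"
    by (intro power_span_sum power_span.scale)
  then show ?thesis by (simp add: det_def[abs_def])
qed

definition polynomial_on_lines :: "(complex ^ 'm ^ 'm \<Rightarrow> complex) \<Rightarrow> bool" where
  "polynomial_on_lines F \<longleftrightarrow> (\<forall>A B. \<exists>P. \<forall>s. F (line_point A B s) = poly P s)"

lemma polynomial_on_lines_add:
  assumes "polynomial_on_lines F" "polynomial_on_lines G"
  shows "polynomial_on_lines (\<lambda>T. F T + G T)"
  unfolding polynomial_on_lines_def
proof (intro allI)
  fix A B
  obtain P Q where "\<And>s. F (line_point A B s) = poly P s" "\<And>s. G (line_point A B s) = poly Q s"
    using assms unfolding polynomial_on_lines_def by meson
  then show "\<exists>R. \<forall>s. F (line_point A B s) + G (line_point A B s) = poly R s"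
    by (intro exI[of _ "P + Q"]) simp
qed

lemma polynomial_on_lines_mult:
  assumes "polynomial_on_lines F" "polynomial_on_lines G"
  shows "polynomial_on_lines (\<lambda>T. F T * G T)"
  unfolding polynomial_on_lines_def
proof (intro allI)
  fix A B
  obtain P Q where "\<And>s. F (line_point A B s) = poly P s" "\<And>s. G (line_point A B s) = poly Q s"
    using assms unfolding polynomial_on_lines_def by meson
  then show "\<exists>R. \<forall>s. F (line_point A B s) * G (line_point A B s) = poly R s"
    by (intro exI[of _ "P * Q"]) simp
qed

lemma polynomial_on_lines_const: "polynomial_on_lines (\<lambda>_. c)"
  unfolding polynomial_on_lines_def by (intro allI exI[of _ "[:c:]"]) simp

lemma power_span_polynomial_on_lines:
  "F \<in> power_span d \<Longrightarrow> polynomial_on_lines F"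
proof (induction rule: power_span.induct)
  case (power Y)
  show ?case unfolding polynomial_on_lines_def
  proof (intro allI)
    fix A B
    show "\<exists>P. \<forall>s. entry_pairing Y (line_point A B s) ^ d = poly P s"
      by (rule exI[of _ "[:entry_pairing Y A, entry_pairing Y B:] ^ d"])
         (simp add: entry_pairing_line_right)
  qed
qed (auto intro: polynomial_on_lines_add polynomial_on_lines_mult polynomial_on_lines_const)

text \<open>The matrix space is irreducible: a line through a point where \<open>F\<close> does not vanish and a
  point where \<open>G\<close> does not vanish reduces this to polynomials in one variable.\<close>

lemma polynomial_on_lines_integral:
  assumes "polynomial_on_lines F" "polynomial_on_lines G" "\<And>T. F T * G T = 0"
  shows "(\<forall>T. F T = 0) \<or> (\<forall>T. G T = 0)"
proof (rule ccontr)
  assume "\<not> ?thesis"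
  then obtain A C where A: "F A \<noteq> 0" and C: "G C \<noteq> 0" by blast
  define B where "B = C - A"
  obtain P Q where P: "\<And>s. F (line_point A B s) = poly P s"
    and Q: "\<And>s. G (line_point A B s) = poly Q s"
    using assms unfolding polynomial_on_lines_def by meson
  have "line_point A B 0 = A" "line_point A B 1 = C"
    by (simp_all add: line_point_def B_def vec_eq_iff)
  then have "P \<noteq> 0" "Q \<noteq> 0" using P[of 0] Q[of 1] A C by auto
  moreover have "poly (P * Q) s = 0" for s using assms(3)[of "line_point A B s"] P Q by simp
  then have "P * Q = 0" using poly_all_0_iff_0 by blast
  ultimately show False by simp
qed


section \<open>Forms\<close>

lemma finite_exponents: "finite {\<alpha> :: 'm :: finite \<Rightarrow> nat. sum \<alpha> UNIV = D}"
proof (rule finite_subset)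
  show "{\<alpha> :: 'm \<Rightarrow> nat. sum \<alpha> UNIV = D} \<subseteq> PiE UNIV (\<lambda>_. {..D})"
    by (auto simp: PiE_def Pi_def member_le_sum)
  show "finite (PiE UNIV (\<lambda>_ :: 'm. {..D}))" by (intro finite_PiE) auto
qed

definition monomial_form :: "('m :: finite \<Rightarrow> nat) \<Rightarrow> complex ^ 'm \<Rightarrow> complex" where
  "monomial_form \<alpha> = (\<lambda>x. \<Prod>i\<in>UNIV. x $ i ^ \<alpha> i)"

lemma forms_altdef:
  "w \<in> forms D \<longleftrightarrow> (\<exists>c. w = (\<lambda>x. \<Sum>\<alpha> | sum \<alpha> UNIV = D. c \<alpha> * monomial_form \<alpha> x))"
  by (simp add: forms_def monomial_form_def)

lemma forms_add:
  assumes "u \<in> forms D" "v \<in> forms D"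
  shows "(\<lambda>x. u x + v x) \<in> forms D"
proof -
  obtain c d where "u = (\<lambda>x. \<Sum>\<alpha> | sum \<alpha> UNIV = D. c \<alpha> * monomial_form \<alpha> x)"
    "v = (\<lambda>x. \<Sum>\<alpha> | sum \<alpha> UNIV = D. d \<alpha> * monomial_form \<alpha> x)"
    using assms by (auto simp: forms_altdef)
  then show ?thesis unfolding forms_altdef
    by (intro exI[of _ "\<lambda>\<alpha>. c \<alpha> + d \<alpha>"]) (simp add: algebra_simps sum.distrib)
qed

lemma forms_scale:
  assumes "u \<in> forms D"
  shows "(\<lambda>x. c * u x) \<in> forms D"
proof -
  obtain d where "u = (\<lambda>x. \<Sum>\<alpha> | sum \<alpha> UNIV = D. d \<alpha> * monomial_form \<alpha> x)"
    using assms by (auto simp: forms_altdef)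
  then show ?thesis unfolding forms_altdef
    by (intro exI[of _ "\<lambda>\<alpha>. c * d \<alpha>"]) (simp add: mult_ac sum_distrib_left)
qed

lemma forms_zero: "(\<lambda>x. 0) \<in> forms D"
  unfolding forms_altdef by (intro exI[of _ "\<lambda>_. 0"]) simp

lemma monomial_form_in_forms:
  assumes "sum \<alpha> UNIV = D" shows "monomial_form \<alpha> \<in> forms D"
proof -
  have "(\<Sum>\<beta> | sum \<beta> UNIV = D. (if \<beta> = \<alpha> then 1 else 0) * monomial_form \<beta> x) = monomial_form \<alpha> x"
    for x
  proof -
    have "(\<Sum>\<beta> | sum \<beta> UNIV = D. (if \<beta> = \<alpha> then 1 else 0) * monomial_form \<beta> x)
        = (\<Sum>\<beta> | sum \<beta> UNIV = D. if \<beta> = \<alpha> then monomial_form \<beta> x else 0)"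
      by (intro sum.cong) auto
    also have "\<dots> = monomial_form \<alpha> x" by (subst sum.delta[OF finite_exponents]) (simp add: assms)
    finally show ?thesis .
  qed
  then show ?thesis unfolding forms_altdef by (intro exI[of _ "\<lambda>\<beta>. if \<beta> = \<alpha> then 1 else 0"]) simp
qed

lemma forms_induct [consumes 1, case_names zero add scale monomial]:
  assumes w: "w \<in> forms D"
    and zero: "P (\<lambda>x. 0)"
    and add: "\<And>u v. P u \<Longrightarrow> P v \<Longrightarrow> P (\<lambda>x. u x + v x)"
    and scale: "\<And>c u. P u \<Longrightarrow> P (\<lambda>x. c * u x)"
    and monomial: "\<And>\<alpha>. sum \<alpha> UNIV = D \<Longrightarrow> P (monomial_form \<alpha>)"
  shows "P w"
proof -
  obtain c where c: "w = (\<lambda>x. \<Sum>\<alpha> | sum \<alpha> UNIV = D. c \<alpha> * monomial_form \<alpha> x)"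
    using w by (auto simp: forms_altdef)
  have "P (\<lambda>x. \<Sum>\<alpha>\<in>A. c \<alpha> * monomial_form \<alpha> x)" if "A \<subseteq> {\<alpha>. sum \<alpha> UNIV = D}" for A
    using that
  proof (induction A rule: infinite_finite_induct)
    case (insert \<alpha> A)
    have "P (\<lambda>x. c \<alpha> * monomial_form \<alpha> x)" "P (\<lambda>x. \<Sum>\<alpha>\<in>A. c \<alpha> * monomial_form \<alpha> x)"
      using insert by (auto intro: scale monomial)
    then show ?case using insert.hyps add by simp
  qed (simp_all add: zero)
  then show ?thesis unfolding c by blast
qed

lemma monomial_form_mult:
  "(\<lambda>x. monomial_form \<alpha> x * monomial_form \<beta> x) = monomial_form (\<lambda>i. \<alpha> i + \<beta> i)"
  by (simp add: monomial_form_def power_add prod.distrib)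

lemma forms_mult:
  assumes "u \<in> forms a" "v \<in> forms b"
  shows "(\<lambda>x. u x * v x) \<in> forms (a + b)"
  using assms(1)
proof (induction rule: forms_induct)
  case (monomial \<alpha>)
  show ?case using assms(2)
  proof (induction rule: forms_induct)
    case (monomial \<beta>)
    show ?case unfolding monomial_form_mult
      by (rule monomial_form_in_forms)
         (simp add: sum.distrib monomial.hyps \<open>sum \<alpha> UNIV = a\<close>)
  next
    case (add u v)
    then show ?case using forms_add[OF add] by (simp add: algebra_simps)
  next
    case (scale c u)
    then show ?case using forms_scale[OF scale, of c] by (simp add: mult_ac)
  qed (simp add: forms_zero)
next
  case (add u v)
  then show ?case using forms_add[OF add] by (simp add: algebra_simps)
next
  case (scale c u)
  then show ?case using forms_scale[OF scale, of c] by (simp add: mult_ac)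
qed (simp add: forms_zero)

lemma forms_const: "(\<lambda>x. c) \<in> forms 0"
  using forms_scale[OF monomial_form_in_forms[of "\<lambda>_. 0" 0], of c] by (simp add: monomial_form_def)

lemma forms_coordinate:
  fixes i :: "'m :: finite"
  shows "(\<lambda>x :: complex ^ 'm. x $ i) \<in> forms 1"
proof -
  have "x $ i = monomial_form (\<lambda>k. if k = i then 1 else 0) x" for x :: "complex ^ 'm"
    by (simp add: monomial_form_def if_distrib[of "\<lambda>n. _ ^ n"] cong: if_cong)
  then show ?thesis
    using monomial_form_in_forms[of "\<lambda>k. if k = i then 1 else 0" 1] by simp
qed

lemma forms_homogeneous:
  assumes "w \<in> forms D" shows "w (t *s x) = t ^ D * w x"
  using assms
proof (induction rule: forms_induct)
  case (monomial \<alpha>)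
  then show ?case
    by (simp add: monomial_form_def power_mult_distrib prod.distrib power_sum[symmetric])
qed (auto simp: algebra_simps)


section \<open>Forms whose coefficients are homogeneous in a matrix\<close>

text \<open>The sums of products \<open>a(g) u(x)\<close> keep the dependence on the matrix \<open>g\<close> apart from that on the variable \<open>x\<close>, so
  that a linear functional on forms can be applied for all \<open>g\<close> at once.\<close>

inductive_set matrix_forms :: "nat \<Rightarrow> (complex ^ 'm ^ 'm \<Rightarrow> complex ^ 'm \<Rightarrow> complex) set" for d where
  base: "a \<in> power_span d \<Longrightarrow> u \<in> forms d \<Longrightarrow> (\<lambda>g x. a g * u x) \<in> matrix_forms d"
| add: "S \<in> matrix_forms d \<Longrightarrow> T \<in> matrix_forms d \<Longrightarrow> (\<lambda>g x. S g x + T g x) \<in> matrix_forms d"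

lemma matrix_forms_zero: "(\<lambda>g x. 0) \<in> matrix_forms d"
  using matrix_forms.base[OF power_span_zero forms_zero] by simp

lemma matrix_forms_sum:
  "(\<And>a. a \<in> A \<Longrightarrow> F a \<in> matrix_forms d) \<Longrightarrow> (\<lambda>g x. \<Sum>a\<in>A. F a g x) \<in> matrix_forms d"
  by (induction A rule: infinite_finite_induct) (auto intro: matrix_forms_zero matrix_forms.add)

lemma matrix_forms_scale:
  assumes "T \<in> matrix_forms d" shows "(\<lambda>g x. c * T g x) \<in> matrix_forms d"
  using assms
proof induction
  case (base a u)
  then show ?case using matrix_forms.base[OF base(1) forms_scale[OF base(2)], of c]
    by (simp add: mult_ac)
next
  case (add S T)
  then show ?case using matrix_forms.add[OF add.IH] by (simp add: algebra_simps)
qed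

lemma matrix_forms_mult:
  assumes "S \<in> matrix_forms a" "T \<in> matrix_forms b"
  shows "(\<lambda>g x. S g x * T g x) \<in> matrix_forms (a + b)"
  using assms(1)
proof induction
  case (base p u)
  show ?case using assms(2)
  proof induction
    case (base q v)
    then show ?case
      using matrix_forms.base[OF power_span_mult[OF \<open>p \<in> _\<close> base(1)] forms_mult[OF \<open>u \<in> _\<close> base(2)]]
      by (simp add: mult_ac)
  next
    case (add S T)
    then show ?case using matrix_forms.add[OF add.IH] by (simp add: algebra_simps)
  qed
next
  case (add S T)
  then show ?case using matrix_forms.add[OF add.IH] by (simp add: algebra_simps)
qed

lemma matrix_forms_one: "(\<lambda>g x. 1) \<in> matrix_forms 0"
  using matrix_forms.base[OF power_span_const[of 1] forms_const[of 1]] by simp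

lemma matrix_forms_power: "T \<in> matrix_forms d \<Longrightarrow> (\<lambda>g x. T g x ^ n) \<in> matrix_forms (d * n)"
  by (induction n) (auto intro: matrix_forms_one matrix_forms_mult)

lemma matrix_forms_prod:
  assumes "finite A" "\<And>a. a \<in> A \<Longrightarrow> F a \<in> matrix_forms (d a)"
  shows "(\<lambda>g x. \<Prod>a\<in>A. F a g x) \<in> matrix_forms (sum d A)"
  using assms
  by (induction A rule: finite_induct) (auto intro: matrix_forms_one matrix_forms_mult)

lemma matrix_forms_coordinate: "(\<lambda>g x. (transpose g *v x) $ i) \<in> matrix_forms 1"
proof -
  have "(\<lambda>g x. \<Sum>j\<in>UNIV. g $ j $ i * x $ j) \<in> matrix_forms 1"
    by (intro matrix_forms_sum matrix_forms.base power_span_entry forms_coordinate)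
  then show ?thesis by (simp add: matrix_vector_mult_def transpose_def)
qed

lemma matrix_forms_act:
  assumes "v \<in> forms D" shows "(\<lambda>g. act g v) \<in> matrix_forms D"
  using assms
proof (induction rule: forms_induct)
  case zero
  then show ?case by (simp add: act_def matrix_forms_zero)
next
  case (add u v)
  then show ?case using matrix_forms.add[OF add] by (simp add: act_def)
next
  case (scale c u)
  then show ?case using matrix_forms_scale[OF scale, of c] by (simp add: act_def)
next
  case (monomial \<alpha>)
  have "(\<lambda>g x. (transpose g *v x) $ i ^ \<alpha> i) \<in> matrix_forms (\<alpha> i)" for i
    using matrix_forms_power[OF matrix_forms_coordinate, of i "\<alpha> i"] by simp
  then show ?case
    using matrix_forms_prod[of UNIV "\<lambda>i g x. (transpose g *v x) $ i ^ \<alpha> i" \<alpha>] monomial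
    by (simp add: act_def monomial_form_def)
qed

lemma matrix_forms_eval: "T \<in> matrix_forms d \<Longrightarrow> T g \<in> forms d"
  by (induction rule: matrix_forms.induct) (auto intro: forms_add forms_scale)

lemma forms_act: "v \<in> forms D \<Longrightarrow> act g v \<in> forms D"
  using matrix_forms_eval[OF matrix_forms_act] .

lemma matrix_forms_functional:
  assumes "T \<in> matrix_forms d" and l: "linear_functional d l"
  shows "(\<lambda>g. l (T g)) \<in> power_span d"
  using assms(1)
proof induction
  case (base a u)
  then show ?case using power_span.scale[OF base(1), of "l u"] l
    by (simp add: linear_functional_def mult.commute)
next
  case (add S T)
  have "l (\<lambda>x. S g x + T g x) = l (S g) + l (T g)" for g
    using l matrix_forms_eval[OF add.hyps(1)] matrix_forms_eval[OF add.hyps(2)]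
    by (simp add: linear_functional_def)
  then show ?case using power_span.add[OF add.IH] by simp
qed


section \<open>Graded structure of the polynomial functions\<close>

definition form_scale :: "complex \<Rightarrow> (complex ^ 'm \<Rightarrow> complex) \<Rightarrow> complex ^ 'm \<Rightarrow> complex" where
  "form_scale c v = (\<lambda>x. c * v x)"

lemma form_scale_in_forms: "v \<in> forms D \<Longrightarrow> form_scale c v \<in> forms D"
  unfolding form_scale_def by (rule forms_scale)

lemma form_scale_1 [simp]: "form_scale 1 v = v"
  and form_scale_form_scale [simp]: "form_scale c (form_scale d v) = form_scale (c * d) v"
  and form_scale_0: "form_scale 0 v = (\<lambda>_. 0)"
  by (simp_all add: form_scale_def mult_ac)

lemma act_form_scale: "act g (form_scale c v) = form_scale c (act g v)"
  by (simp add: act_def form_scale_def)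

lemma act_act: "act g (act h v) = act (g ** h) v"
  by (simp only: act_def matrix_vector_mul_assoc matrix_transpose_mul)

lemma act_one: "act (mat 1) v = v"
  by (simp add: act_def transpose_mat)

lemma act_scalar:
  fixes v :: "complex ^ 'm \<Rightarrow> complex"
  assumes "v \<in> forms D" shows "act (mat t) v = form_scale (t ^ D) v"
proof -
  have "mat t *v x = t *s x" for x :: "complex ^ 'm"
    by (simp add: vec_eq_iff matrix_vector_mult_def mat_def if_distrib[of "\<lambda>x. x * _"] cong: if_cong)
  then show ?thesis
    by (simp add: act_def form_scale_def transpose_mat forms_homogeneous[OF assms])
qed

text \<open>The degree \<open>j\<close> is recorded along the construction of a polynomial function; the zero function has every degree.\<close>

inductive hom_function :: "nat \<Rightarrow> nat \<Rightarrow> ((complex ^ 'm \<Rightarrow> complex) \<Rightarrow> complex) \<Rightarrow> bool" for D where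
  const: "hom_function D 0 (\<lambda>_. c)"
| linear: "linear_functional D l \<Longrightarrow> hom_function D 1 l"
| add: "hom_function D j p \<Longrightarrow> hom_function D j q \<Longrightarrow> hom_function D j (\<lambda>v. p v + q v)"
| mult: "hom_function D i p \<Longrightarrow> hom_function D j q \<Longrightarrow> hom_function D (i + j) (\<lambda>v. p v * q v)"

lemma hom_functions_poly: "hom_function D j p \<Longrightarrow> p \<in> poly_functions D"
  by (induction rule: hom_function.induct) (auto intro: poly_functions.intros)

lemma hom_functions_scale:
  "hom_function D j p \<Longrightarrow> v \<in> forms D \<Longrightarrow> p (form_scale c v) = c ^ j * p v"
  by (induction rule: hom_function.induct)
     (auto simp: linear_functional_def form_scale_def algebra_simps power_add)

lemma linear_functional_act:
  "linear_functional D l \<Longrightarrow> linear_functional D (\<lambda>v. l (act M v))"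
  unfolding linear_functional_def using forms_act[of _ D M] by (auto simp: act_def)

lemma hom_functions_act: "hom_function D j p \<Longrightarrow> hom_function D j (\<lambda>v. p (act M v))"
  by (induction rule: hom_function.induct) (auto intro: hom_function.intros[simplified] linear_functional_act)

lemma hom_functions_cmult: "hom_function D j p \<Longrightarrow> hom_function D j (\<lambda>v. c * p v)"
  using hom_function.mult[OF hom_function.const] by fastforce

lemma hom_functions_zero: "hom_function D j (\<lambda>v. 0)"
proof (induction j)
  case 0
  show ?case by (rule hom_function.const)
next
  case (Suc j)
  have "linear_functional D (\<lambda>v. 0)" by (simp add: linear_functional_def)
  then show ?case using hom_function.mult[OF hom_function.linear Suc] by simp
qed

lemma hom_functions_sum:
  "(\<And>a. a \<in> A \<Longrightarrow> hom_function D j (F a)) \<Longrightarrow> hom_function D j (\<lambda>v. \<Sum>a\<in>A. F a v)"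
  by (induction A rule: infinite_finite_induct) (auto intro: hom_functions_zero hom_function.add)

text \<open>The parts above the bound \<open>N\<close> are required to vanish so that \<open>P n\<close> is the part of degree \<open>n\<close> for
  every \<open>n\<close>, and so that two decompositions can be given a common bound.\<close>

lemma poly_functions_graded:
  assumes "p \<in> poly_functions D"
  shows "\<exists>P N. (\<forall>j. hom_function D j (P j)) \<and> (\<forall>j>N. P j = (\<lambda>_. 0)) \<and> (\<forall>v. p v = (\<Sum>j\<le>N. P j v))"
  using assms
proof induction
  case (const c)
  show ?case
    by (rule exI[of _ "\<lambda>j. if j = 0 then (\<lambda>_. c) else (\<lambda>_. 0)"], rule exI[of _ 0])
       (auto intro: hom_function.const hom_functions_zero)
next
  case (linear l)
  then show ?case
    by (intro exI[of _ "\<lambda>j. if j = 1 then l else (\<lambda>_. 0)"] exI[of _ 1])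
       (auto intro: hom_function.linear[simplified] hom_functions_zero)
next
  case (add p q)
  then obtain P N Q M where P: "\<And>j. hom_function D j (P j)" "\<And>j. j > N \<Longrightarrow> P j = (\<lambda>_. 0)"
      "\<And>v. p v = (\<Sum>j\<le>N. P j v)"
    and Q: "\<And>j. hom_function D j (Q j)" "\<And>j. j > M \<Longrightarrow> Q j = (\<lambda>_. 0)"
      "\<And>v. q v = (\<Sum>j\<le>M. Q j v)" by metis
  have "(\<Sum>j\<le>N. P j v) = (\<Sum>j\<le>N + M. P j v)" for v
    by (rule sum.mono_neutral_left) (use P(2) in \<open>auto simp: not_le\<close>)
  moreover have "(\<Sum>j\<le>M. Q j v) = (\<Sum>j\<le>N + M. Q j v)" for v
    by (rule sum.mono_neutral_left) (use Q(2) in \<open>auto simp: not_le\<close>)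
  ultimately show ?case
    using P Q
    by (intro exI[of _ "\<lambda>j v. P j v + Q j v"] exI[of _ "N + M"])
       (auto intro: hom_function.add simp: sum.distrib)
next
  case (mult p q)
  then obtain P N Q M where P: "\<And>j. hom_function D j (P j)" "\<And>j. j > N \<Longrightarrow> P j = (\<lambda>_. 0)"
      "\<And>v. p v = (\<Sum>j\<le>N. P j v)"
    and Q: "\<And>j. hom_function D j (Q j)" "\<And>j. j > M \<Longrightarrow> Q j = (\<lambda>_. 0)"
      "\<And>v. q v = (\<Sum>j\<le>M. Q j v)" by metis
  define T where "T = (\<lambda>n v. \<Sum>i\<le>n. P i v * Q (n - i) v)"
  have "hom_function D n (T n)" for n
    unfolding T_def
  proof (rule hom_functions_sum)
    fix i assume "i \<in> {..n}"
    then show "hom_function D n (\<lambda>v. P i v * Q (n - i) v)"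
      using hom_function.mult[OF P(1)[of i] Q(1)[of "n - i"]] by simp
  qed
  moreover have "T n = (\<lambda>_. 0)" if "n > N + M" for n
  proof -
    have zero: "P i v * Q (n - i) v = 0" for i v
      using that P(2)[of i] Q(2)[of "n - i"] by (cases "i > N") auto
    show ?thesis by (simp only: T_def zero sum.neutral_const)
  qed
  moreover have "p v * q v = (\<Sum>n\<le>N + M. T n v)" for v
  proof -
    have "p v * q v = (\<Sum>i\<le>N. \<Sum>j\<le>M. P i v * Q j v)"
      by (simp add: P(3) Q(3) sum_product)
    also have "\<dots> = (\<Sum>(i, j)\<in>{..N} \<times> {..M}. P i v * Q j v)" by (simp add: sum.cartesian_product)
    also have "\<dots> = (\<Sum>(i, j)\<in>{(i, j). i + j \<le> N + M}. P i v * Q j v)"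
    proof (rule sum.mono_neutral_left)
      have "{(i, j). i + j \<le> N + M} \<subseteq> {..N + M} \<times> {..N + M}" by auto
      then show "finite {(i, j). i + j \<le> N + M}" by (rule finite_subset) simp
    qed (auto, (metis P(2) Q(2) leI)+)
    also have "\<dots> = (\<Sum>n\<le>N + M. T n v)" by (simp add: sum.triangle_reindex_eq T_def)
    finally show ?thesis .
  qed
  ultimately show ?case by blast
qed

lemma poly_functions_sum:
  "(\<And>a. a \<in> A \<Longrightarrow> F a \<in> poly_functions D) \<Longrightarrow> (\<lambda>v. \<Sum>a\<in>A. F a v) \<in> poly_functions D"
  by (induction A rule: infinite_finite_induct) (auto intro: poly_functions.intros)

lemma poly_functions_prod:
  "(\<And>a. a \<in> A \<Longrightarrow> F a \<in> poly_functions D) \<Longrightarrow> (\<lambda>v. \<Prod>a\<in>A. F a v) \<in> poly_functions D"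
  by (induction A rule: infinite_finite_induct) (auto intro: poly_functions.intros)

lemma poly_functions_power: "p \<in> poly_functions D \<Longrightarrow> (\<lambda>v. p v ^ n) \<in> poly_functions D"
  by (induction n) (auto intro: poly_functions.intros)

lemma poly_functions_cmult: "p \<in> poly_functions D \<Longrightarrow> (\<lambda>v. c * p v) \<in> poly_functions D"
  by (intro poly_functions.mult poly_functions.const)

lemma poly_functions_diff:
  "p \<in> poly_functions D \<Longrightarrow> q \<in> poly_functions D \<Longrightarrow> (\<lambda>v. p v - q v) \<in> poly_functions D"
  using poly_functions.add[OF _ poly_functions_cmult[of q D "-1"], of p] by simp

lemma poly_functions_act: "p \<in> poly_functions D \<Longrightarrow> (\<lambda>v. p (act M v)) \<in> poly_functions D"
  by (induction rule: poly_functions.induct) (auto intro: poly_functions.intros linear_functional_act)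

lemma linear_functional_form_scale:
  "linear_functional D l \<Longrightarrow> linear_functional D (\<lambda>v. l (form_scale c v))"
proof -
  assume l: "linear_functional D l"
  have "l (form_scale c v) = c * l v" if "v \<in> forms D" for v
    using l that by (simp add: linear_functional_def form_scale_def)
  then show ?thesis
    using l by (simp add: linear_functional_def forms_add forms_scale algebra_simps)
qed

lemma poly_functions_form_scale:
  "p \<in> poly_functions D \<Longrightarrow> (\<lambda>v. p (form_scale c v)) \<in> poly_functions D"
  by (induction rule: poly_functions.induct)
     (auto intro: poly_functions.intros linear_functional_form_scale)

lemma poly_functions_along_scaling:
  assumes "p \<in> poly_functions D" "v \<in> forms D"
  shows "\<exists>P. \<forall>c. p (form_scale c v) = poly P c"
proof -
  obtain P N where P: "\<And>j. hom_function D j (P j)" "\<And>v. p v = (\<Sum>j\<le>N. P j v)"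
    using poly_functions_graded[OF assms(1)] by metis
  then show ?thesis
    by (intro exI[of _ "\<Sum>j\<le>N. Polynomial.monom (P j v) j"])
       (simp add: poly_sum poly_monom hom_functions_scale[OF P(1) assms(2)] mult_ac)
qed

lemma hom_functions_act_power_span:
  assumes "hom_function D j p" "v \<in> forms D"
  shows "(\<lambda>g. p (act g v)) \<in> power_span (D * j)"
  using assms(1)
proof induction
  case (linear l)
  then show ?case using matrix_forms_functional[OF matrix_forms_act[OF assms(2)]] by simp
qed (auto simp: algebra_simps intro: power_span_const power_span.add power_span_mult)

lemma poly_functions_act_on_lines:
  assumes "p \<in> poly_functions D" "v \<in> forms D"
  shows "polynomial_on_lines (\<lambda>g. p (act g v))"
  using assms(1)
proof induction
  case (linear l)
  then show ?case
    using power_span_polynomial_on_lines[OF matrix_forms_functional[OF matrix_forms_act[OF assms(2)]]]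
    by simp
qed (auto intro: polynomial_on_lines_const polynomial_on_lines_add polynomial_on_lines_mult)


section \<open>Matrices of determinant one\<close>

lemma nth_root_exists:
  assumes "n > 0" shows "\<exists>z :: complex. z ^ n = c"
proof (cases "c = 0")
  case False
  then have "card {z. z ^ n = c} > 0" using assms by (simp add: card_nth_roots)
  then have "{z. z ^ n = c} \<noteq> {}" by (metis card.empty less_irrefl)
  then show ?thesis by blast
qed (use assms in \<open>auto intro: exI[of _ 0]\<close>)

lemma det_scalar: "det (mat t :: complex ^ 'm ^ 'm) = t ^ CARD('m)"
  by (subst det_diagonal) (auto simp: mat_def)

lemma scalar_times_det_one:
  fixes g :: "complex ^ 'm ^ 'm"
  assumes "det g \<noteq> 0" and t: "t ^ CARD('m) = det g"
  obtains s where "t \<noteq> 0" "det s = 1" "g = mat t ** s"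
proof -
  have t0: "t \<noteq> 0" using t assms by (auto simp: power_0_left)
  have "mat t ** mat (1 / t) = (mat 1 :: complex ^ 'm ^ 'm)"
    using t0 by (simp add: vec_eq_iff matrix_matrix_mult_def mat_def if_distrib[of "\<lambda>x. _ * x"] cong: if_cong)
  then have "g = mat t ** (mat (1 / t) ** g)" by (simp add: matrix_mul_assoc)
  moreover have "det (mat (1 / t) ** g) = 1"
    using t t0 assms by (simp add: det_mul det_scalar power_divide)
  ultimately show ?thesis using that t0 by blast
qed

section \<open>An invariant functional\<close>

lemma entry_pairing_pairs:
  "entry_pairing Y T = (\<Sum>p\<in>UNIV. Y $ fst p $ snd p * T $ fst p $ snd p)"
  unfolding entry_pairing_def sum.cartesian_product by (simp add: case_prod_beta)

text \<open>The products of \<open>d\<close> matrix entries, indexed by words of length \<open>d\<close> in the index pairs. Words instead of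
  exponent vectors make the expansion of a \<open>d\<close>-th power free of multinomial coefficients.\<close>

definition word_monomial :: "nat \<Rightarrow> (nat \<Rightarrow> 'm \<times> 'm) \<Rightarrow> complex ^ 'm ^ 'm \<Rightarrow> complex" where
  "word_monomial d \<iota> T = (\<Prod>k<d. T $ fst (\<iota> k) $ snd (\<iota> k))"

lemma entry_pairing_power:
  "entry_pairing Y T ^ d
     = (\<Sum>\<iota>\<in>PiE {..<d} (\<lambda>_. UNIV). word_monomial d \<iota> Y * word_monomial d \<iota> T)"
proof -
  have "entry_pairing Y T ^ d = (\<Prod>k<d. \<Sum>p\<in>UNIV. Y $ fst p $ snd p * T $ fst p $ snd p)"
    by (simp add: entry_pairing_pairs)
  also have "\<dots> = (\<Sum>\<iota>\<in>PiE {..<d} (\<lambda>_. UNIV). word_monomial d \<iota> Y * word_monomial d \<iota> T)"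
    by (subst prod_sum_PiE) (simp_all add: word_monomial_def prod.distrib)
  finally show ?thesis .
qed

definition cnj_matrix :: "complex ^ 'm ^ 'm \<Rightarrow> complex ^ 'm ^ 'm" where
  "cnj_matrix M = (\<chi> i j. cnj (M $ i $ j))"

lemma cnj_matrix_cnj_matrix [simp]: "cnj_matrix (cnj_matrix M) = M"
  by (simp add: cnj_matrix_def vec_eq_iff)

lemma det_cnj_matrix: "det (cnj_matrix M) = cnj (det M)"
  by (simp add: det_def cnj_matrix_def)

lemma entry_pairing_cnj_matrix:
  "entry_pairing (cnj_matrix Y) (cnj_matrix T) = cnj (entry_pairing Y T)"
  by (simp add: entry_pairing_def cnj_matrix_def)

lemma word_monomial_cnj_matrix: "word_monomial d \<iota> (cnj_matrix T) = cnj (word_monomial d \<iota> T)"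
  by (simp add: word_monomial_def cnj_matrix_def)

lemma entry_pairing_commute: "entry_pairing Y T = entry_pairing T Y"
  by (simp add: entry_pairing_def mult.commute)

lemma entry_pairing_mult:
  "entry_pairing Y (M ** h) = entry_pairing (Y ** transpose h) M"
proof -
  have "entry_pairing Y (M ** h)
      = (\<Sum>i\<in>UNIV. \<Sum>j\<in>UNIV. \<Sum>k\<in>UNIV. Y $ i $ j * (M $ i $ k * h $ k $ j))"
    by (simp add: entry_pairing_def matrix_matrix_mult_def sum_distrib_left)
  also have "\<dots> = (\<Sum>i\<in>UNIV. \<Sum>k\<in>UNIV. \<Sum>j\<in>UNIV. Y $ i $ j * (M $ i $ k * h $ k $ j))"
    by (intro sum.cong refl sum.swap)
  also have "\<dots> = entry_pairing (Y ** transpose h) M"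
    by (simp add: entry_pairing_def matrix_matrix_mult_def sum_distrib_left sum_distrib_right transpose_def mult_ac)
  finally show ?thesis .
qed

lemma power_span_finite_sum:
  assumes "F \<in> power_span d"
  shows "\<exists>A c. finite A \<and> F = (\<lambda>T. \<Sum>M\<in>A. c M * entry_pairing M T ^ d)"
  using assms
proof induction
  case (power Y)
  show ?case by (intro exI[of _ "{Y}"] exI[of _ "\<lambda>_. 1"]) simp
next
  case (add F G)
  from add.IH(1) obtain A c
    where A: "finite A" "F = (\<lambda>T. \<Sum>M\<in>A. c M * entry_pairing M T ^ d)" by blast
  from add.IH(2) obtain B d'
    where B: "finite B" "G = (\<lambda>T. \<Sum>M\<in>B. d' M * entry_pairing M T ^ d)" by blast
  let ?c = "\<lambda>M. (if M \<in> A then c M else 0) + (if M \<in> B then d' M else 0)"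
  have "(\<Sum>M\<in>A \<union> B. ?c M * entry_pairing M T ^ d) = F T + G T" for T
  proof -
    have "(\<Sum>M\<in>A \<union> B. (if M \<in> A then c M else 0) * entry_pairing M T ^ d) = F T"
      using A B unfolding A(2) by (intro sum.mono_neutral_cong_right) auto
    moreover have "(\<Sum>M\<in>A \<union> B. (if M \<in> B then d' M else 0) * entry_pairing M T ^ d) = G T"
      using A B unfolding B(2) by (intro sum.mono_neutral_cong_right) auto
    ultimately show ?thesis by (simp add: distrib_right sum.distrib)
  qed
  then show ?case using A B by (intro exI[of _ "A \<union> B"] exI[of _ ?c]) auto
next
  case (scale F c)
  from scale.IH obtain A b
    where A: "finite A" "F = (\<lambda>T. \<Sum>M\<in>A. b M * entry_pairing M T ^ d)" by blast
  then show ?case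
    by (intro exI[of _ A] exI[of _ "\<lambda>M. c * b M"]) (simp add: sum_distrib_left mult_ac)
qed

text \<open>Write \<open>det\<^sup>R\<close> as a combination of kernels \<open>\<langle>M, T\<rangle>\<^sup>d\<close> with coefficients \<open>c(M)\<close>. The functional evaluates at the
  conjugates of these \<open>M\<close> with the conjugate coefficients. On a kernel \<open>\<langle>Y, T\<rangle>\<^sup>d\<close> it takes the value
  \<open>det(Y)\<^sup>R\<close>, since \<open>det\<^sup>R\<close> has real coefficients. Translation by \<open>h\<close> replaces \<open>Y\<close> by \<open>Y h\<^sup>T\<close> and
  does not change this value. On \<open>det\<^sup>R\<close> the functional is a sum of squared absolute values of moments, which
  cannot all be zero because they determine \<open>det\<^sup>R\<close>.\<close>

lemma invariant_functional:
  fixes R :: nat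
  shows "\<exists>(A :: (complex ^ 'm ^ 'm) set) a (N :: complex ^ 'm ^ 'm \<Rightarrow> complex ^ 'm ^ 'm).
    (\<forall>F\<in>power_span (CARD('m) * R). \<forall>h. det h = 1 \<longrightarrow>
       (\<Sum>M\<in>A. a M * F (N M ** h)) = (\<Sum>M\<in>A. a M * F (N M))) \<and>
    (\<Sum>M\<in>A. a M * det (N M) ^ R) \<noteq> 0"
proof -
  let ?d = "CARD('m) * R"
  let ?W = "PiE {..<?d} (\<lambda>_. UNIV :: ('m \<times> 'm) set)"
  obtain A :: "(complex ^ 'm ^ 'm) set" and c
    where A: "finite A" and rep: "(\<lambda>T. det T ^ R) = (\<lambda>T. \<Sum>M\<in>A. c M * entry_pairing M T ^ ?d)"
    using power_span_finite_sum[OF power_span_power[OF power_span_det]] by blast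
  have detR: "det T ^ R = (\<Sum>M\<in>A. c M * entry_pairing M T ^ ?d)" for T
    using fun_cong[OF rep] .
  have reproduce: "(\<Sum>M\<in>A. cnj (c M) * entry_pairing Y (cnj_matrix M ** h) ^ ?d) = det Y ^ R"
    if h: "det h = 1" for Y h
  proof -
    have "entry_pairing Y (cnj_matrix M ** h)
        = cnj (entry_pairing M (cnj_matrix (Y ** transpose h)))" for M
    proof -
      have "entry_pairing Y (cnj_matrix M ** h)
          = entry_pairing (cnj_matrix (cnj_matrix (Y ** transpose h))) (cnj_matrix M)"
        by (simp add: entry_pairing_mult)
      also have "\<dots> = cnj (entry_pairing M (cnj_matrix (Y ** transpose h)))"
        unfolding entry_pairing_cnj_matrix by (subst entry_pairing_commute) (rule refl)
      finally show ?thesis .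
    qed
    then have "(\<Sum>M\<in>A. cnj (c M) * entry_pairing Y (cnj_matrix M ** h) ^ ?d)
        = cnj (\<Sum>M\<in>A. c M * entry_pairing M (cnj_matrix (Y ** transpose h)) ^ ?d)"
      by simp
    also have "\<dots> = det (Y ** transpose h) ^ R"
      by (simp add: detR[symmetric] det_cnj_matrix)
    also have "\<dots> = det Y ^ R" using h by (simp add: det_mul)
    finally show ?thesis .
  qed
  have inv: "(\<Sum>M\<in>A. cnj (c M) * F (cnj_matrix M ** h)) = (\<Sum>M\<in>A. cnj (c M) * F (cnj_matrix M))"
    if "F \<in> power_span ?d" and h: "det h = 1" for F h
    using that(1)
  proof induction
    case (power Y)
    show ?case using reproduce[of h Y] reproduce[of "mat 1" Y] h by simp
  next
    case (add F G)
    then show ?case by (simp add: distrib_left sum.distrib)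
  next
    case (scale F b)
    have "(\<Sum>M\<in>A. cnj (c M) * (b * F (cnj_matrix M ** h)))
        = b * (\<Sum>M\<in>A. cnj (c M) * F (cnj_matrix M ** h))"
      by (simp add: sum_distrib_left mult_ac)
    also have "\<dots> = (\<Sum>M\<in>A. cnj (c M) * (b * F (cnj_matrix M)))"
      by (simp add: scale.IH sum_distrib_left mult_ac)
    finally show ?case .
  qed
  define moment where "moment = (\<lambda>\<iota>. \<Sum>M\<in>A. c M * word_monomial ?d \<iota> M)"
  have detR': "det T ^ R = (\<Sum>\<iota>\<in>?W. moment \<iota> * word_monomial ?d \<iota> T)" for T
  proof -
    have "det T ^ R = (\<Sum>M\<in>A. \<Sum>\<iota>\<in>?W. c M * (word_monomial ?d \<iota> M * word_monomial ?d \<iota> T))"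
      by (simp add: detR entry_pairing_power sum_distrib_left)
    also have "\<dots> = (\<Sum>\<iota>\<in>?W. moment \<iota> * word_monomial ?d \<iota> T)"
      unfolding moment_def by (subst sum.swap) (simp add: sum_distrib_left sum_distrib_right mult_ac)
    finally show ?thesis .
  qed
  have "(\<Sum>M\<in>A. cnj (c M) * det (cnj_matrix M) ^ R)
      = (\<Sum>M\<in>A. \<Sum>\<iota>\<in>?W. cnj (c M) * (moment \<iota> * cnj (word_monomial ?d \<iota> M)))"
    by (simp add: detR' word_monomial_cnj_matrix sum_distrib_left)
  also have "\<dots> = (\<Sum>\<iota>\<in>?W. moment \<iota> * cnj (moment \<iota>))"
    by (subst sum.swap) (simp add: moment_def sum_distrib_left mult_ac)
  also have "\<dots> = of_real (\<Sum>\<iota>\<in>?W. (cmod (moment \<iota>))\<^sup>2)"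
    by (simp only: of_real_sum complex_norm_square)
  finally have L_det: "(\<Sum>M\<in>A. cnj (c M) * det (cnj_matrix M) ^ R)
      = of_real (\<Sum>\<iota>\<in>?W. (cmod (moment \<iota>))\<^sup>2)" .
  have "(\<Sum>M\<in>A. cnj (c M) * det (cnj_matrix M) ^ R) \<noteq> 0"
  proof
    assume "(\<Sum>M\<in>A. cnj (c M) * det (cnj_matrix M) ^ R) = 0"
    then have "(\<Sum>\<iota>\<in>?W. (cmod (moment \<iota>))\<^sup>2) = 0" unfolding L_det of_real_eq_0_iff .
    moreover have "finite ?W" by (intro finite_PiE) auto
    ultimately have "moment \<iota> = 0" if "\<iota> \<in> ?W" for \<iota>
      using that by (subst (asm) sum_nonneg_eq_0_iff) auto
    then have "det (mat 1 :: complex ^ 'm ^ 'm) ^ R = 0" unfolding detR' by (intro sum.neutral) simp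
    then show False by simp
  qed
  then show ?thesis using inv
    by (intro exI[of _ A] exI[of _ "\<lambda>M. cnj (c M)"] exI[of _ cnj_matrix]) blast
qed


section \<open>Invariants that do not vanish on a closed orbit\<close>

text \<open>Normalize \<open>p\<close> to a function without constant part that is \<open>1\<close> on the orbit. The scalar matrices of
  determinant one show that the parts whose degree in \<open>g\<close> is not divisible by \<open>m\<close> contribute nothing to this sum. Filled up by
  powers of \<open>det g\<close> to a common degree, the other parts add up to \<open>det(g)\<^sup>R\<close>. The invariant functional sends
  each of them to an invariant, and it does not vanish on the sum.\<close>

lemma invariant_of_separation:
  fixes w :: "complex ^ 'm \<Rightarrow> complex"
  assumes w: "w \<in> forms D" and p: "p \<in> poly_functions D"
    and p_orbit: "\<And>s. det s = 1 \<Longrightarrow> p (act s w) = 0" and p_0: "p (\<lambda>_. 0) \<noteq> 0"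
  obtains j f where "j > 0" "hom_function D j f" "f w \<noteq> 0"
    "\<And>s v. v \<in> forms D \<Longrightarrow> det s = 1 \<Longrightarrow> f (act s v) = f v"
proof -
  let ?m = "CARD('m)"
  obtain P N where P: "\<And>j. hom_function D j (P j)" "\<And>v. p v = (\<Sum>j\<le>N. P j v)"
    using poly_functions_graded[OF p] by metis
  define c where "c = p (\<lambda>_. 0)"
  define Q where "Q = (\<lambda>j. if j = 0 then (\<lambda>_. 0) else (\<lambda>v. - 1 / c * P j v))"
  have Q: "hom_function D j (Q j)" for j
    using hom_functions_cmult[where c = "- 1 / c", OF P(1)[of j]]
    by (cases "j = 0") (simp_all add: Q_def hom_functions_zero)
  have P0: "P 0 v = c" if "v \<in> forms D" for v
  proof -
    have "c = (\<Sum>j\<le>N. P j (form_scale 0 v))" by (simp add: c_def form_scale_0 P(2)[symmetric])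
    also have "\<dots> = (\<Sum>j\<le>N. if j = 0 then P 0 v else 0)"
      by (intro sum.cong) (auto simp: hom_functions_scale[OF P(1) that])
    finally show ?thesis by simp
  qed
  have Q_orbit: "(\<Sum>j\<le>N. Q j (act s w)) = 1" if "det s = 1" for s
  proof -
    have "(\<Sum>j\<le>N. Q j (act s w)) = (\<Sum>j\<le>N. (if j = 0 then 1 else 0) + (- 1 / c) * P j (act s w))"
      using P0[OF forms_act[OF w, of s]] p_0
      by (intro sum.cong) (auto simp: Q_def c_def)
    also have "\<dots> = 1 + (- 1 / c) * (\<Sum>j\<le>N. P j (act s w))"
      unfolding sum.distrib sum_distrib_left[symmetric] by simp
    finally show ?thesis using p_orbit[OF that] by (simp add: P(2)[symmetric])
  qed
  \<comment> \<open>for these \<open>j\<close> the degree \<open>D j\<close> of \<open>g \<mapsto> Q j (g v)\<close> is that of a power of the determinant\<close>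
  define J where "J = {j. j \<le> N \<and> ?m dvd D * j}"
  have fin: "finite J" by (simp add: J_def)
  define r where "r = (\<lambda>j. D * j div ?m)"
  have r: "D * j = ?m * r j" if "j \<in> J" for j using that by (simp add: J_def r_def)
  define R where "R = D * N"
  have r_le: "r j \<le> R" if "j \<in> J" for j
  proof -
    have "r j \<le> D * j" unfolding r_def by (rule div_le_dividend)
    also have "\<dots> \<le> R" using that by (simp add: J_def R_def)
    finally show ?thesis .
  qed
  have Q_J: "(\<Sum>j\<in>J. Q j (act s w)) = 1" if s: "det s = 1" for s
  proof -
    define b where "b = (\<lambda>k. (\<Sum>j | j \<le> N \<and> (D * j) mod ?m = k. Q j (act s w)) - (if k = 0 then 1 else 0))"
    have "b 0 = 0"
    proof (rule coefficients_eq_0)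
      fix z :: complex assume z: "z ^ ?m = 1"
      have zmod: "z ^ (n mod ?m) = z ^ n" for n
      proof -
        have "z ^ n = z ^ (?m * (n div ?m) + n mod ?m)" by simp
        also have "\<dots> = z ^ (n mod ?m)" unfolding power_add power_mult z by simp
        finally show ?thesis by simp
      qed
      have "det (mat z ** s) = 1" using z s by (simp add: det_mul det_scalar)
      then have "1 = (\<Sum>j\<le>N. Q j (act (mat z ** s) w))" by (simp add: Q_orbit)
      also have "\<dots> = (\<Sum>j\<le>N. z ^ (D * j) * Q j (act s w))"
        by (simp add: act_act[symmetric] act_scalar[OF forms_act[OF w]]
            hom_functions_scale[OF Q forms_act[OF w]] power_mult)
      also have "\<dots> = (\<Sum>k<?m. \<Sum>j | j \<in> {..N} \<and> (D * j) mod ?m = k. z ^ (D * j) * Q j (act s w))"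
        by (rule sum.group[symmetric]) auto
      also have "\<dots> = (\<Sum>k<?m. z ^ k * (\<Sum>j | j \<le> N \<and> (D * j) mod ?m = k. Q j (act s w)))"
        unfolding sum_distrib_left
        by (intro sum.cong) (auto simp: zmod[symmetric, of "D * _"])
      finally have "1 = (\<Sum>k<?m. z ^ k * (\<Sum>j | j \<le> N \<and> (D * j) mod ?m = k. Q j (act s w)))" .
      moreover have "(\<Sum>k<?m. z ^ k * (if k = 0 then 1 else 0)) = (\<Sum>k<?m. if k = 0 then 1 else 0)"
        by (intro sum.cong) auto
      then have "(\<Sum>k<?m. z ^ k * (if k = 0 then 1 else 0)) = 1" by simp
      ultimately show "(\<Sum>k<?m. z ^ k * b k) = 0"
        unfolding b_def right_diff_distrib sum_subtractf by simp
    qed simp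
    then show ?thesis by (simp add: b_def J_def dvd_eq_mod_eq_0)
  qed
  have ident: "(\<Sum>j\<in>J. det g ^ (R - r j) * Q j (act g w)) = det g ^ R" for g
  proof -
    let ?E = "\<lambda>g. (\<Sum>j\<in>J. det g ^ (R - r j) * Q j (act g w)) + (- 1) * det g ^ R"
    have E_span: "?E \<in> power_span (?m * R)"
    proof (intro power_span.add power_span_sum power_span.scale power_span_power power_span_det)
      fix j assume j: "j \<in> J"
      have "(\<lambda>g. det g ^ (R - r j) * Q j (act g w)) \<in> power_span (?m * (R - r j) + D * j)"
        by (intro power_span_mult power_span_power power_span_det hom_functions_act_power_span[OF Q w])
      moreover have "?m * (R - r j) + D * j = ?m * R"
        using r[OF j] r_le[OF j] by (simp add: distrib_left[symmetric])
      ultimately show "(\<lambda>g. det g ^ (R - r j) * Q j (act g w)) \<in> power_span (?m * R)" by simp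
    qed
    \<comment> \<open>the identity holds on \<open>GL\<^sub>m\<close>; the factor \<open>det g\<close> makes it a polynomial identity on all matrices, and
      the functional below evaluates at matrices that may be singular\<close>
    have "?E g * det g = 0" for g
    proof (cases "det g = 0")
      case False
      obtain t where t: "t ^ ?m = det g" using nth_root_exists[of ?m] by auto
      obtain s where s: "det s = 1" "g = mat t ** s" using scalar_times_det_one[OF False t] .
      have "det g ^ (R - r j) * Q j (act g w) = det g ^ R * Q j (act s w)" if j: "j \<in> J" for j
      proof -
        have "Q j (act g w) = t ^ (D * j) * Q j (act s w)"
          unfolding s(2) act_act[symmetric] act_scalar[OF forms_act[OF w]]
          by (simp add: hom_functions_scale[OF Q forms_act[OF w]] power_mult)
        also have "\<dots> = det g ^ r j * Q j (act s w)" unfolding r[OF j] power_mult t ..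
        finally show ?thesis using r_le[OF j] by (simp add: power_add[symmetric] mult.assoc[symmetric])
      qed
      then have "(\<Sum>j\<in>J. det g ^ (R - r j) * Q j (act g w)) = det g ^ R * (\<Sum>j\<in>J. Q j (act s w))"
        by (simp add: sum_distrib_left)
      then show ?thesis using Q_J[OF s(1)] by simp
    qed simp
    then have "(\<forall>g. ?E g = 0) \<or> (\<forall>g :: complex ^ 'm ^ 'm. det g = 0)"
      using polynomial_on_lines_integral[OF power_span_polynomial_on_lines[OF E_span]
          power_span_polynomial_on_lines[OF power_span_det]] by blast
    moreover have "det (mat 1 :: complex ^ 'm ^ 'm) \<noteq> 0" by simp
    ultimately have "?E g = 0" by blast
    then show ?thesis by simp
  qed
  obtain A :: "(complex ^ 'm ^ 'm) set" and a
    and M :: "complex ^ 'm ^ 'm \<Rightarrow> complex ^ 'm ^ 'm" where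
    inv: "\<forall>F\<in>power_span (?m * R). \<forall>h. det h = 1 \<longrightarrow>
       (\<Sum>i\<in>A. a i * F (M i ** h)) = (\<Sum>i\<in>A. a i * F (M i))"
    and nonzero: "(\<Sum>i\<in>A. a i * det (M i) ^ R) \<noteq> 0"
    using invariant_functional[where 'm = 'm and R = R] by blast
  define f where "f = (\<lambda>j v. \<Sum>i\<in>A. a i * (det (M i) ^ (R - r j) * Q j (act (M i) v)))"
  have "(\<Sum>j\<in>J. f j w) = (\<Sum>i\<in>A. a i * (\<Sum>j\<in>J. det (M i) ^ (R - r j) * Q j (act (M i) w)))"
    unfolding f_def by (subst sum.swap) (simp add: sum_distrib_left)
  also have "\<dots> \<noteq> 0" using nonzero by (simp add: ident)
  finally obtain j where j: "j \<in> J" "f j w \<noteq> 0" by (meson sum.neutral)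
  show ?thesis
  proof (rule that[of j "f j"])
    show "j > 0" using j(2) by (cases j) (simp_all add: f_def Q_def)
    show "hom_function D j (f j)"
      unfolding f_def
      by (intro hom_functions_sum hom_functions_cmult hom_functions_act[OF Q])
    show "f j w \<noteq> 0" by fact
    fix s :: "complex ^ 'm ^ 'm" and v :: "complex ^ 'm \<Rightarrow> complex"
    assume v: "v \<in> forms D" and s: "det s = 1"
    have "(\<lambda>g. det g ^ (R - r j) * Q j (act g v)) \<in> power_span (?m * (R - r j) + D * j)"
      by (intro power_span_mult power_span_power power_span_det hom_functions_act_power_span[OF Q v])
    moreover have "?m * (R - r j) + D * j = ?m * R"
      using r[OF j(1)] r_le[OF j(1)] by (simp add: distrib_left[symmetric])
    ultimately have "(\<lambda>g. det g ^ (R - r j) * Q j (act g v)) \<in> power_span (?m * R)" by simp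
    from bspec[OF inv this] s have
      "(\<Sum>i\<in>A. a i * (det (M i ** s) ^ (R - r j) * Q j (act (M i ** s) v)))
        = (\<Sum>i\<in>A. a i * (det (M i) ^ (R - r j) * Q j (act (M i) v)))" by blast
    then show "f j (act s v) = f j v"
      using s by (simp add: f_def act_act det_mul)
  qed
qed


section \<open>Coordinate rings\<close>

lemma carrier_coordinate_ring:
  "carrier (coordinate_ring D Y) = (\<lambda>p. restrict p Y) ` poly_functions D"
  by (simp add: coordinate_ring_def)

lemma restrict_in_coordinate_ring:
  "p \<in> poly_functions D \<Longrightarrow> restrict p Y \<in> carrier (coordinate_ring D Y)"
  by (simp add: carrier_coordinate_ring)

lemma coordinate_ring_mult:
  "restrict p Y \<otimes>\<^bsub>coordinate_ring D Y\<^esub> restrict q Y = (\<lambda>v\<in>Y. p v * q v)"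
  by (auto simp: coordinate_ring_def restrict_def)

lemma coordinate_ring_add:
  "restrict p Y \<oplus>\<^bsub>coordinate_ring D Y\<^esub> restrict q Y = (\<lambda>v\<in>Y. p v + q v)"
  by (auto simp: coordinate_ring_def restrict_def)

lemma coordinate_ring_one: "\<one>\<^bsub>coordinate_ring D Y\<^esub> = (\<lambda>v\<in>Y. 1)"
  and coordinate_ring_zero: "\<zero>\<^bsub>coordinate_ring D Y\<^esub> = (\<lambda>v\<in>Y. 0)"
  by (simp_all add: coordinate_ring_def)

lemmas coordinate_ring_simps =
  coordinate_ring_mult coordinate_ring_add coordinate_ring_one coordinate_ring_zero

lemma restrict_eq_iff: "restrict p Y = restrict q Y \<longleftrightarrow> (\<forall>v\<in>Y. p v = q v)"
  by (metis restrict_apply restrict_ext)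

lemma cring_coordinate_ring: "cring (coordinate_ring D Y)"
proof (rule cringI)
  show "abelian_group (coordinate_ring D Y)"
  proof (rule abelian_groupI, goal_cases)
    case (6 f)
    then obtain p where p: "p \<in> poly_functions D" "f = restrict p Y"
      by (auto simp: carrier_coordinate_ring)
    then show ?case
      by (intro bexI[of _ "restrict (\<lambda>v. - 1 * p v) Y"])
         (simp_all only: coordinate_ring_simps restrict_in_coordinate_ring poly_functions_cmult, simp)
  qed (auto simp: carrier_coordinate_ring coordinate_ring_simps restrict_eq_iff
      intro!: imageI intro: poly_functions.intros)
  show "comm_monoid (coordinate_ring D Y)"
    by (rule comm_monoidI) (auto simp: carrier_coordinate_ring coordinate_ring_simps restrict_eq_iff
      intro!: imageI intro: poly_functions.intros)
qed (auto simp: carrier_coordinate_ring coordinate_ring_simps restrict_eq_iff algebra_simps)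

lemma coordinate_ring_pow:
  "restrict p Y [^]\<^bsub>coordinate_ring D Y\<^esub> (n :: nat) = (\<lambda>v\<in>Y. p v ^ n)"
proof -
  interpret cring "coordinate_ring D Y" by (rule cring_coordinate_ring)
  show ?thesis
    by (induction n) (simp_all only: nat_pow_0 nat_pow_Suc coordinate_ring_simps power_0 power_Suc2)
qed


section \<open>The orbit of a polystable form and its closure\<close>

lemma poly_eq_away_0:
  fixes P Q :: "complex poly"
  assumes "\<And>c. c \<noteq> 0 \<Longrightarrow> poly P c = poly Q c" shows "P = Q"
proof (rule ccontr)
  assume "P \<noteq> Q"
  then have "finite {c. poly (P - Q) c = 0}" by (intro poly_roots_finite) simp
  moreover have "- {0} \<subseteq> {c. poly (P - Q) c = 0}" using assms by auto
  moreover have "infinite (- {0 :: complex})" by (simp add: infinite_UNIV_char_0)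
  ultimately show False using finite_subset by blast
qed

lemma det_one_inverse:
  fixes s :: "complex ^ 'm ^ 'm"
  assumes "det s = 1" obtains s' where "det s' = 1" "s' ** s = mat 1"
proof -
  have "invertible s" using assms by (simp add: invertible_det_nz)
  then obtain s' where s': "s' ** s = mat 1" by (auto simp: invertible_def)
  then have "det s' * det s = 1" by (metis det_mul det_I)
  then show ?thesis using that s' assms by simp
qed

lemma card_preimage_power:
  fixes M :: "complex set"
  assumes "finite M" "0 \<notin> M" "k > 0"
  shows "card {t. t ^ k \<in> M} = k * card M" and "finite {t. t ^ k \<in> M}"
proof -
  have eq: "{t. t ^ k \<in> M} = (\<Union>z\<in>M. {t. t ^ k = z})" by auto
  have "card {t. t ^ k \<in> M} = (\<Sum>z\<in>M. card {t. t ^ k = z})"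
    unfolding eq by (rule card_UN_disjoint) (use assms in \<open>auto simp: finite_nth_roots\<close>)
  also have "\<dots> = (\<Sum>z\<in>M. k)"
    by (intro sum.cong refl card_nth_roots) (use assms in auto)
  finally show "card {t. t ^ k \<in> M} = k * card M" by simp
  show "finite {t. t ^ k \<in> M}" unfolding eq using assms by (auto simp: finite_nth_roots)
qed

text \<open>A polynomial identity along a punctured line through the origin extends to the origin.\<close>

lemma poly_functions_extend_scaling:
  assumes p: "p \<in> poly_functions D" and v: "v \<in> forms D"
    and eq: "\<And>c. c \<noteq> 0 \<Longrightarrow> p (form_scale c v) = c ^ d * a"
  shows "p (form_scale c v) = c ^ d * a"
proof -
  obtain P where P: "\<And>c. p (form_scale c v) = poly P c"
    using poly_functions_along_scaling[OF p v] by blast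
  have "P = Polynomial.monom a d"
    by (rule poly_eq_away_0) (simp add: P[symmetric] eq poly_monom mult.commute)
  then show ?thesis by (simp add: P poly_monom mult.commute)
qed

locale polystable_form =
  fixes D :: nat and w :: "complex ^ 'm \<Rightarrow> complex"
  assumes D: "D \<ge> 1" and w: "w \<in> forms D" and w_nonzero: "w \<noteq> (\<lambda>_. 0)"
    and polystable: "polystable D w"
begin

abbreviation S :: "(complex ^ 'm \<Rightarrow> complex) set" where "S \<equiv> orbit SL act w"

abbreviation Y :: "(complex ^ 'm \<Rightarrow> complex) set" where "Y \<equiv> orbit_closure D w"

lemma S_iff: "u \<in> S \<longleftrightarrow> (\<exists>s. det s = 1 \<and> u = act s w)"
  by (auto simp: orbit_def SL_def)

lemma S_forms: "u \<in> S \<Longrightarrow> u \<in> forms D"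
  by (auto simp: S_iff forms_act[OF w])

lemma w_in_S: "w \<in> S"
  unfolding S_iff by (rule exI[of _ "mat 1"]) (simp add: act_one)

lemma S_act: "u \<in> S \<Longrightarrow> det s = 1 \<Longrightarrow> act s u \<in> S"
  unfolding S_iff by (auto simp: act_act det_mul intro: exI[of _ "s ** _"])

lemma S_transitive:
  assumes "u \<in> S" obtains s where "det s = 1" "act s u = w"
proof -
  obtain s where s: "det s = 1" "u = act s w" using assms by (auto simp: S_iff)
  obtain s' where "det s' = 1" "s' ** s = mat 1" using det_one_inverse[OF s(1)] .
  then show ?thesis using that s by (simp add: act_act act_one)
qed

lemma zero_notin_S: "(\<lambda>_. 0) \<notin> S"
proof
  assume "(\<lambda>_. 0) \<in> S"
  then obtain s where "act s (\<lambda>_. 0) = w" using S_transitive by metis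
  then show False using w_nonzero by (simp add: act_def)
qed

lemma S_closed:
  assumes "v \<in> forms D" "v \<notin> S"
  obtains p where "p \<in> poly_functions D" "\<And>u. u \<in> S \<Longrightarrow> p u = 0" "p v \<noteq> 0"
  using assms polystable unfolding polystable_def zariski_closure_def by blast

text \<open>A matrix of \<open>GL\<^sub>m\<close> is a scalar matrix times one of determinant one, and the scalar matrices act on
  forms of positive degree by all nonzero scalars.\<close>

lemma orbit_GL_iff:
  "v \<in> orbit GL act w \<longleftrightarrow> (\<exists>c u. c \<noteq> 0 \<and> u \<in> S \<and> v = form_scale c u)"
proof
  assume "v \<in> orbit GL act w"
  then obtain g where g: "det g \<noteq> 0" "v = act g w"
    by (auto simp: orbit_def GL_def invertible_det_nz)
  obtain t where t: "t ^ CARD('m) = det g" using nth_root_exists[of "CARD('m)"] by auto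
  obtain s where s: "t \<noteq> 0" "det s = 1" "g = mat t ** s" using scalar_times_det_one[OF g(1) t] .
  have "v = form_scale (t ^ D) (act s w)"
    by (simp add: g(2) s(3) act_act[symmetric] act_scalar[OF forms_act[OF w]])
  then show "\<exists>c u. c \<noteq> 0 \<and> u \<in> S \<and> v = form_scale c u"
    using s by (intro exI[of _ "t ^ D"] exI[of _ "act s w"]) (auto simp: S_iff)
next
  assume "\<exists>c u. c \<noteq> 0 \<and> u \<in> S \<and> v = form_scale c u"
  then obtain c s where c: "c \<noteq> 0" "det s = 1" "v = form_scale c (act s w)"
    by (auto simp: S_iff)
  obtain t where t: "t ^ D = c" using nth_root_exists[of D c] D by auto
  then have "t \<noteq> 0" using c(1) D by (auto simp: power_0_left)
  then have "invertible (mat t ** s)" using c(2) by (simp add: invertible_det_nz det_mul det_scalar)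
  moreover have "v = act (mat t ** s) w"
    by (simp add: c(3) t act_act[symmetric] act_scalar[OF forms_act[OF w]])
  ultimately show "v \<in> orbit GL act w" by (auto simp: orbit_def GL_def)
qed

lemma Y_iff:
  "v \<in> Y \<longleftrightarrow> v \<in> forms D \<and>
    (\<forall>p\<in>poly_functions D. (\<forall>c u. c \<noteq> 0 \<longrightarrow> u \<in> S \<longrightarrow> p (form_scale c u) = 0) \<longrightarrow> p v = 0)"
proof -
  have "(\<forall>u\<in>orbit GL act w. p u = 0) \<longleftrightarrow> (\<forall>c u. c \<noteq> 0 \<longrightarrow> u \<in> S \<longrightarrow> p (form_scale c u) = 0)"
    for p :: "(complex ^ 'm \<Rightarrow> complex) \<Rightarrow> complex"
    unfolding Ball_def orbit_GL_iff by blast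
  then show ?thesis unfolding orbit_closure_def zariski_closure_def by simp
qed

lemma Y_forms: "v \<in> Y \<Longrightarrow> v \<in> forms D"
  by (simp add: Y_iff)

lemma scale_in_Y: "c \<noteq> 0 \<Longrightarrow> u \<in> S \<Longrightarrow> form_scale c u \<in> Y"
  by (auto simp: Y_iff form_scale_in_forms S_forms)

lemma S_subset_Y: "u \<in> S \<Longrightarrow> u \<in> Y"
  using scale_in_Y[of 1 u] by simp

lemma eq_on_Y:
  assumes "p \<in> poly_functions D" "q \<in> poly_functions D"
    and "\<And>c u. c \<noteq> 0 \<Longrightarrow> u \<in> S \<Longrightarrow> p (form_scale c u) = q (form_scale c u)" and "v \<in> Y"
  shows "p v = q v"
proof -
  have "p v - q v = 0"
    using assms(4) bspec[of _ _ "\<lambda>v. p v - q v"] poly_functions_diff[OF assms(1,2)] assms(3)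
    unfolding Y_iff by fastforce
  then show ?thesis by simp
qed

text \<open>The form \<open>c w\<close> lies in the orbit for \<open>c \<noteq> 0\<close> and tends to \<open>0\<close>.\<close>

lemma zero_in_Y: "(\<lambda>_. 0) \<in> Y"
proof -
  have "p (\<lambda>_. 0) = 0"
    if p: "p \<in> poly_functions D" and 0: "\<And>c u. c \<noteq> 0 \<Longrightarrow> u \<in> S \<Longrightarrow> p (form_scale c u) = 0" for p
  proof -
    obtain P where P: "\<And>c. p (form_scale c w) = poly P c"
      using poly_functions_along_scaling[OF p w] by blast
    have "P = 0" using P 0[OF _ w_in_S] by (intro poly_eq_away_0) simp
    then show ?thesis using P[of 0] by (simp add: form_scale_0)
  qed
  then show ?thesis by (simp add: Y_iff forms_zero)
qed

lemma Y_scale: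
  assumes "v \<in> Y" shows "form_scale t v \<in> Y"
proof (cases "t = 0")
  case False
  show ?thesis unfolding Y_iff
  proof (intro conjI ballI impI)
    fix p assume p: "p \<in> poly_functions D" "\<forall>c u. c \<noteq> 0 \<longrightarrow> u \<in> S \<longrightarrow> p (form_scale c u) = 0"
    show "p (form_scale t v) = 0"
      by (rule eq_on_Y[OF poly_functions_form_scale[OF p(1)] poly_functions.const _ assms])
         (use p(2) False in simp)
  qed (use assms in \<open>simp add: form_scale_in_forms Y_forms\<close>)
qed (simp add: form_scale_0 zero_in_Y)

lemma Y_act:
  assumes "v \<in> Y" "det s = 1" shows "act s v \<in> Y"
  unfolding Y_iff
proof (intro conjI ballI impI)
  fix p assume p: "p \<in> poly_functions D" "\<forall>c u. c \<noteq> 0 \<longrightarrow> u \<in> S \<longrightarrow> p (form_scale c u) = 0"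
  show "p (act s v) = 0"
    by (rule eq_on_Y[OF poly_functions_act[OF p(1)] poly_functions.const _ assms(1)])
       (use p(2) S_act[OF _ assms(2)] in \<open>simp add: act_form_scale\<close>)
qed (use assms in \<open>simp add: forms_act Y_forms\<close>)

text \<open>The orbit closure is irreducible because it is the closure of the image of \<open>GL\<^sub>m\<close>. The factor \<open>det\<close> turns a
  statement about \<open>GL\<^sub>m\<close> into one about the irreducible space of all matrices.\<close>

lemma Y_integral:
  assumes p: "p \<in> poly_functions D" and q: "q \<in> poly_functions D"
    and 0: "\<And>v. v \<in> Y \<Longrightarrow> p v * q v = 0"
  shows "(\<forall>v\<in>Y. p v = 0) \<or> (\<forall>v\<in>Y. q v = 0)"
proof -
  have orbit: "act g w \<in> orbit GL act w" if "det g \<noteq> 0" for g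
    using that by (auto simp: orbit_def GL_def invertible_det_nz)
  have vanish: "\<forall>v\<in>Y. r v = 0" if "r \<in> poly_functions D" "\<And>g. r (act g w) = 0" for r
  proof -
    have "r (form_scale c u) = 0" if "c \<noteq> 0" "u \<in> S" for c u
    proof -
      have "form_scale c u \<in> orbit GL act w" using that orbit_GL_iff by blast
      then obtain g where "form_scale c u = act g w" by (auto simp: orbit_def)
      then show ?thesis using \<open>\<And>g. r (act g w) = 0\<close> by simp
    qed
    then show ?thesis using eq_on_Y[OF that(1) poly_functions.const] by blast
  qed
  note lines = poly_functions_act_on_lines[OF p w] poly_functions_act_on_lines[OF q w]
    and det_lines = power_span_polynomial_on_lines[OF power_span_det]
  have "p (act g w) * (q (act g w) * det g) = 0" for g
    using 0[of "act g w"] orbit[of g] by (cases "det g = 0") (auto simp: orbit_GL_iff scale_in_Y)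
  then have "(\<forall>g. p (act g w) = 0) \<or> (\<forall>g. q (act g w) * det g = 0)"
    by (rule polynomial_on_lines_integral[OF lines(1) polynomial_on_lines_mult[OF lines(2) det_lines]])
  moreover have "(\<forall>g. q (act g w) = 0) \<or> (\<forall>g :: complex ^ 'm ^ 'm. det g = 0)"
    if "\<forall>g. q (act g w) * det g = 0"
    by (rule polynomial_on_lines_integral[OF lines(2) det_lines]) (use that in blast)
  moreover have "det (mat 1 :: complex ^ 'm ^ 'm) \<noteq> 0" by simp
  ultimately show ?thesis using vanish[OF p] vanish[OF q] by metis
qed

lemma domain_coordinate_ring: "domain (coordinate_ring D Y)"
proof (intro domain.intro domain_axioms.intro cring_coordinate_ring)
  show "\<one>\<^bsub>coordinate_ring D Y\<^esub> \<noteq> \<zero>\<^bsub>coordinate_ring D Y\<^esub>"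
    using zero_in_Y by (auto simp: coordinate_ring_simps restrict_eq_iff)
  fix f g
  assume fg: "f \<otimes>\<^bsub>coordinate_ring D Y\<^esub> g = \<zero>\<^bsub>coordinate_ring D Y\<^esub>"
    and "f \<in> carrier (coordinate_ring D Y)" "g \<in> carrier (coordinate_ring D Y)"
  then obtain p q where p: "p \<in> poly_functions D" "f = restrict p Y"
    and q: "q \<in> poly_functions D" "g = restrict q Y"
    by (auto simp: carrier_coordinate_ring)
  show "f = \<zero>\<^bsub>coordinate_ring D Y\<^esub> \<or> g = \<zero>\<^bsub>coordinate_ring D Y\<^esub>"
    using fg Y_integral[OF p(1) q(1)] unfolding p(2) q(2) coordinate_ring_simps restrict_eq_iff by blast
qed


section \<open>The fundamental invariant\<close>

text \<open>Invariance and homogeneity on \<open>Y\<close> can be checked on the dense orbit, and there both together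
  prescribe all values from the one at \<open>w\<close>.\<close>

lemma SL_invariants_iff:
  assumes p: "p \<in> poly_functions D"
  shows "restrict p Y \<in> SL_invariants D Y d \<longleftrightarrow>
    (\<forall>c u. c \<noteq> 0 \<longrightarrow> u \<in> S \<longrightarrow> p (form_scale c u) = c ^ d * p w)"
proof -
  have inv_iff: "restrict p Y \<in> SL_invariants D Y d \<longleftrightarrow>
      (\<forall>s v. det s = 1 \<longrightarrow> v \<in> Y \<longrightarrow> p (act s v) = p v) \<and>
      (\<forall>t v. v \<in> Y \<longrightarrow> p (form_scale t v) = t ^ d * p v)"
    unfolding SL_invariants_def
    using p Y_act Y_scale by (auto simp: SL_def restrict_in_coordinate_ring form_scale_def)
  show ?thesis
  proof
    assume "restrict p Y \<in> SL_invariants D Y d"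
    then have i1: "\<And>s v. det s = 1 \<Longrightarrow> v \<in> Y \<Longrightarrow> p (act s v) = p v"
      and i2: "\<And>t v. v \<in> Y \<Longrightarrow> p (form_scale t v) = t ^ d * p v"
      unfolding inv_iff by blast+
    show "\<forall>c u. c \<noteq> 0 \<longrightarrow> u \<in> S \<longrightarrow> p (form_scale c u) = c ^ d * p w"
      using i1[OF _ S_subset_Y[OF w_in_S]] i2[OF S_subset_Y] by (auto simp: S_iff)
  next
    assume "\<forall>c u. c \<noteq> 0 \<longrightarrow> u \<in> S \<longrightarrow> p (form_scale c u) = c ^ d * p w"
    then have h: "p (form_scale c u) = c ^ d * p w" if "u \<in> S" for c u
      using poly_functions_extend_scaling[OF p S_forms[OF that]] that by blast
    show "restrict p Y \<in> SL_invariants D Y d"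
      unfolding inv_iff
    proof (intro conjI allI impI)
      fix s :: "complex ^ 'm ^ 'm" and v assume s: "det s = 1" and v: "v \<in> Y"
      show "p (act s v) = p v"
        by (rule eq_on_Y[OF poly_functions_act[OF p] p _ v])
           (use h S_act[OF _ s] in \<open>simp add: act_form_scale\<close>)
    next
      fix t v assume v: "v \<in> Y"
      show "p (form_scale t v) = t ^ d * p v"
        by (rule eq_on_Y[OF poly_functions_form_scale[OF p] poly_functions_cmult[OF p] _ v])
           (simp add: h power_mult_distrib)
    qed
  qed
qed


lemma zero_in_SL_invariants: "\<zero>\<^bsub>coordinate_ring D Y\<^esub> \<in> SL_invariants D Y d"
  using SL_invariants_iff[OF poly_functions.const[of 0 D], of d] by (simp add: coordinate_ring_simps)

lemma nonzero_invariant_iff: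
  "SL_invariants D Y d \<noteq> {\<zero>\<^bsub>coordinate_ring D Y\<^esub>} \<longleftrightarrow>
    (\<exists>p\<in>poly_functions D. p w \<noteq> 0 \<and> (\<forall>c u. c \<noteq> 0 \<longrightarrow> u \<in> S \<longrightarrow> p (form_scale c u) = c ^ d * p w))"
proof
  assume "SL_invariants D Y d \<noteq> {\<zero>\<^bsub>coordinate_ring D Y\<^esub>}"
  then obtain f where f: "f \<in> SL_invariants D Y d" "f \<noteq> \<zero>\<^bsub>coordinate_ring D Y\<^esub>"
    using zero_in_SL_invariants by blast
  then obtain p where p: "p \<in> poly_functions D" "f = restrict p Y"
    by (auto simp: SL_invariants_def carrier_coordinate_ring)
  have inv: "\<forall>c u. c \<noteq> 0 \<longrightarrow> u \<in> S \<longrightarrow> p (form_scale c u) = c ^ d * p w"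
    using f(1) SL_invariants_iff[OF p(1)] p(2) by blast
  have "p w \<noteq> 0"
  proof
    assume "p w = 0"
    then have "p (form_scale c u) = 0" if "c \<noteq> 0" "u \<in> S" for c u
      using inv that by simp
    then have "\<forall>v\<in>Y. p v = 0" using eq_on_Y[OF p(1) poly_functions.const[of 0]] by blast
    then show False using f(2) by (simp add: p(2) coordinate_ring_simps restrict_eq_iff)
  qed
  then show "\<exists>p\<in>poly_functions D. p w \<noteq> 0 \<and>
      (\<forall>c u. c \<noteq> 0 \<longrightarrow> u \<in> S \<longrightarrow> p (form_scale c u) = c ^ d * p w)"
    using p(1) inv by (intro bexI[of _ p] conjI)
next
  assume "\<exists>p\<in>poly_functions D. p w \<noteq> 0 \<and>
      (\<forall>c u. c \<noteq> 0 \<longrightarrow> u \<in> S \<longrightarrow> p (form_scale c u) = c ^ d * p w)"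
  then obtain p where p: "p \<in> poly_functions D" "p w \<noteq> 0" "restrict p Y \<in> SL_invariants D Y d"
    using SL_invariants_iff by blast
  then have "restrict p Y \<noteq> \<zero>\<^bsub>coordinate_ring D Y\<^esub>"
    using S_subset_Y[OF w_in_S] by (auto simp: coordinate_ring_simps restrict_eq_iff)
  then show "SL_invariants D Y d \<noteq> {\<zero>\<^bsub>coordinate_ring D Y\<^esub>}" using p(3) by blast
qed

text \<open>Since \<open>S\<close> is closed and does not contain \<open>0\<close>, some polynomial function separates \<open>0\<close> from \<open>S\<close>.\<close>

lemma exists_nonzero_invariant:
  "\<exists>d>0. SL_invariants D Y d \<noteq> {\<zero>\<^bsub>coordinate_ring D Y\<^esub>}"
proof -
  obtain p where p: "p \<in> poly_functions D" "\<And>u. u \<in> S \<Longrightarrow> p u = 0" "p (\<lambda>_. 0) \<noteq> 0"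
    using S_closed[OF forms_zero zero_notin_S] by metis
  obtain j f where f: "j > 0" "hom_function D j f" "f w \<noteq> 0"
    "\<And>s v. v \<in> forms D \<Longrightarrow> det s = 1 \<Longrightarrow> f (act s v) = f v"
    by (rule invariant_of_separation[OF w p(1) _ p(3)]) (use p(2) S_iff in auto)
  have "f (form_scale c u) = c ^ j * f w" if "u \<in> S" for c u
    using that f(4)[OF w] hom_functions_scale[OF f(2) S_forms[OF that]] by (auto simp: S_iff)
  then show ?thesis
    using f(1,3) hom_functions_poly[OF f(2)] nonzero_invariant_iff[of j] by blast
qed

abbreviation e :: nat where "e \<equiv> minimal_degree D w"

lemma minimal_degree_in:
  "e \<in> {d. d > 0 \<and> SL_invariants D Y d \<noteq> {\<zero>\<^bsub>coordinate_ring D Y\<^esub>}}"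
  unfolding minimal_degree_def using exists_nonzero_invariant by (intro Inf_nat_def1) blast

lemma e_pos: "e > 0"
  using minimal_degree_in by simp

lemma no_invariant_below_e:
  assumes p: "p \<in> poly_functions D" and d: "0 < d" "d < e"
    and inv: "\<And>c u. c \<noteq> 0 \<Longrightarrow> u \<in> S \<Longrightarrow> p (form_scale c u) = c ^ d * p w"
  shows "p w = 0"
proof (rule ccontr)
  assume "p w \<noteq> 0"
  then have "SL_invariants D Y d \<noteq> {\<zero>\<^bsub>coordinate_ring D Y\<^esub>}"
    using p inv nonzero_invariant_iff by blast
  then have "e \<le> d"
    unfolding minimal_degree_def using d by (intro wellorder_Inf_le1) simp
  then show False using d by simp
qed

text \<open>A polynomial function on all forms that restricts to the fundamental invariant; only its values
  on \<open>Y\<close> are determined.\<close>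

definition \<phi> :: "(complex ^ 'm \<Rightarrow> complex) \<Rightarrow> complex" where
  "\<phi> = (SOME p. p \<in> poly_functions D \<and> p w = 1 \<and>
     (\<forall>c u. c \<noteq> 0 \<longrightarrow> u \<in> S \<longrightarrow> p (form_scale c u) = c ^ e))"

lemma \<phi>_poly: "\<phi> \<in> poly_functions D"
  and \<phi>_w: "\<phi> w = 1"
  and \<phi>_orbit: "u \<in> S \<Longrightarrow> \<phi> (form_scale c u) = c ^ e"
proof -
  obtain p where p: "p \<in> poly_functions D" "p w \<noteq> 0"
    "\<And>c u. c \<noteq> 0 \<Longrightarrow> u \<in> S \<Longrightarrow> p (form_scale c u) = c ^ e * p w"
    using minimal_degree_in nonzero_invariant_iff by blast
  then have "(\<lambda>v. inverse (p w) * p v) \<in> poly_functions D \<and> inverse (p w) * p w = 1 \<and>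
      (\<forall>c u. c \<noteq> 0 \<longrightarrow> u \<in> S \<longrightarrow> inverse (p w) * p (form_scale c u) = c ^ e)"
    by (simp add: poly_functions_cmult)
  then have *: "\<phi> \<in> poly_functions D \<and> \<phi> w = 1 \<and>
      (\<forall>c u. c \<noteq> 0 \<longrightarrow> u \<in> S \<longrightarrow> \<phi> (form_scale c u) = c ^ e)"
    unfolding \<phi>_def by (rule someI[of "\<lambda>p. p \<in> poly_functions D \<and> p w = 1 \<and>
     (\<forall>c u. c \<noteq> 0 \<longrightarrow> u \<in> S \<longrightarrow> p (form_scale c u) = c ^ e)"])
  then show "\<phi> \<in> poly_functions D" "\<phi> w = 1" by auto
  show "\<phi> (form_scale c u) = c ^ e" if "u \<in> S"
    using poly_functions_extend_scaling[of \<phi> D u e 1 c] * S_forms[OF that] that by simp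
qed

lemma \<phi>_S: "u \<in> S \<Longrightarrow> \<phi> u = 1"
  using \<phi>_orbit[of u 1] by simp

lemma \<phi>_scale: "v \<in> Y \<Longrightarrow> \<phi> (form_scale t v) = t ^ e * \<phi> v"
  by (rule eq_on_Y[OF poly_functions_form_scale[OF \<phi>_poly] poly_functions_cmult[OF \<phi>_poly]])
     (simp_all add: \<phi>_orbit power_mult_distrib)

lemma fundamental_invariant_eq: "fundamental_invariant D w = restrict \<phi> Y"
  unfolding fundamental_invariant_def
proof (rule the_equality)
  show "restrict \<phi> Y \<in> SL_invariants D Y e \<and> restrict \<phi> Y w = 1"
    using SL_invariants_iff[OF \<phi>_poly] \<phi>_orbit \<phi>_w S_subset_Y[OF w_in_S] by simp
next
  fix f assume f: "f \<in> SL_invariants D Y e \<and> f w = 1"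
  then obtain p where p: "p \<in> poly_functions D" "f = restrict p Y"
    by (auto simp: SL_invariants_def carrier_coordinate_ring)
  have "p w = 1" using f p(2) S_subset_Y[OF w_in_S] by simp
  then have "p (form_scale c u) = \<phi> (form_scale c u)" if "c \<noteq> 0" "u \<in> S" for c u
    using f SL_invariants_iff[OF p(1)] that unfolding p(2) by (simp add: \<phi>_orbit)
  then show "f = restrict \<phi> Y"
    unfolding p(2) restrict_eq_iff using eq_on_Y[OF p(1) \<phi>_poly] by blast
qed


section \<open>The periods\<close>

text \<open>The stabilizer of the set \<open>S\<close> among the scalars; its order turns out to be the degree period.\<close>

definition \<mu> :: "complex set" where
  "\<mu> = {z. form_scale z w \<in> S}"

abbreviation n :: nat where "n \<equiv> card \<mu>"

lemma mem_\<mu>_iff: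
  assumes "u \<in> S" shows "form_scale z u \<in> S \<longleftrightarrow> z \<in> \<mu>"
proof -
  obtain s where s: "det s = 1" "act s u = w" using S_transitive[OF assms] .
  obtain s' where s': "det s' = 1" "u = act s' w" using assms by (auto simp: S_iff)
  have "act s (form_scale z u) = form_scale z w" "act s' (form_scale z w) = form_scale z u"
    using s(2) s'(2) by (simp_all add: act_form_scale)
  then show ?thesis using S_act[OF _ s(1)] S_act[OF _ s'(1)] unfolding \<mu>_def by (metis mem_Collect_eq)
qed

lemma \<mu>_power_e: "z \<in> \<mu> \<Longrightarrow> z ^ e = 1"
  using \<phi>_orbit[OF w_in_S, of z] \<phi>_S[of "form_scale z w"] by (simp add: \<mu>_def)

lemma zero_notin_\<mu>: "0 \<notin> \<mu>"
  using \<mu>_power_e[of 0] e_pos by (auto simp: power_0_left)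

lemma one_in_\<mu>: "1 \<in> \<mu>"
  by (simp add: \<mu>_def w_in_S)

lemma \<mu>_mult: "z \<in> \<mu> \<Longrightarrow> z' \<in> \<mu> \<Longrightarrow> z * z' \<in> \<mu>"
  using mem_\<mu>_iff[of "form_scale z' w" z] by (simp add: \<mu>_def)

lemma finite_\<mu>: "finite \<mu>"
  using finite_subset[of \<mu> "{z. z ^ e = 1}"] \<mu>_power_e e_pos finite_nth_roots[of e 1] by blast

lemma n_pos: "n > 0"
  using one_in_\<mu> finite_\<mu> by (auto simp: card_gt_0_iff)

text \<open>As in Lagrange's theorem, multiplication by \<open>z \<in> \<mu>\<close> permutes \<open>\<mu>\<close>; comparing the products of all elements
  gives \<open>z\<^sup>n = 1\<close>.\<close>

lemma \<mu>_eq: "\<mu> = {z. z ^ n = 1}"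
proof (rule card_subset_eq)
  show "finite {z :: complex. z ^ n = 1}" using n_pos by (rule finite_nth_roots)
  show "card \<mu> = card {z :: complex. z ^ n = 1}" using n_pos by (simp add: card_nth_roots)
  show "\<mu> \<subseteq> {z. z ^ n = 1}"
  proof
    fix z assume z: "z \<in> \<mu>"
    have z0: "z \<noteq> 0" using z zero_notin_\<mu> by auto
    have "inj_on ((*) z) \<mu>" using z0 by (auto simp: inj_on_def)
    moreover have "(*) z ` \<mu> = \<mu>"
      using calculation \<mu>_mult[OF z] finite_\<mu> by (intro endo_inj_surj) auto
    ultimately have "prod (\<lambda>x. x) \<mu> = (\<Prod>x\<in>\<mu>. z * x)"
      using prod.reindex[of "(*) z" \<mu> "\<lambda>x. x"] by simp
    also have "\<dots> = z ^ n * prod (\<lambda>x. x) \<mu>" by (simp add: prod.distrib)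
    finally have "prod (\<lambda>x. x) \<mu> = z ^ n * prod (\<lambda>x. x) \<mu>" .
    moreover have "prod (\<lambda>x. x) \<mu> \<noteq> 0" using zero_notin_\<mu> finite_\<mu> by auto
    ultimately show "z \<in> {z. z ^ n = 1}" by simp
  qed
qed

text \<open>The \<open>e\<close>-th power is a character of \<open>\<mu>\<close>. It is trivial, and the character sum would be \<open>0\<close> if \<open>n\<close> did
  not divide \<open>e\<close>.\<close>

lemma n_dvd_e: "n dvd e"
proof (rule ccontr)
  assume "\<not> n dvd e"
  then have "(\<Sum>z\<in>\<mu>. z ^ e) = 0"
    using sum_powers_roots_of_unity[OF n_pos, of e] by (simp add: \<mu>_eq[symmetric])
  moreover have "(\<Sum>z\<in>\<mu>. z ^ e) = of_nat n" by (simp add: \<mu>_power_e)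
  ultimately show False using n_pos by simp
qed

text \<open>A matrix \<open>t s\<close> with \<open>det s = 1\<close> fixes \<open>w\<close> iff \<open>t\<^sup>D s w = w\<close>, which says that \<open>t\<^sup>D\<close> carries a point of \<open>S\<close>
  into \<open>S\<close>.\<close>

lemma stabilizer_det_iff: "t ^ CARD('m) \<in> det ` stabilizer GL act w \<longleftrightarrow> t ^ D \<in> \<mu>"
proof
  assume "t ^ CARD('m) \<in> det ` stabilizer GL act w"
  then obtain g where g: "det g \<noteq> 0" "act g w = w" "t ^ CARD('m) = det g"
    by (auto simp: stabilizer_def GL_def invertible_det_nz)
  obtain s where s: "det s = 1" "g = mat t ** s" using scalar_times_det_one[OF g(1,3)] .
  have "form_scale (t ^ D) (act s w) = w"
    using g(2) by (simp add: s(2) act_act[symmetric] act_scalar[OF forms_act[OF w]])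
  moreover have "act s w \<in> S" using s(1) by (auto simp: S_iff)
  ultimately show "t ^ D \<in> \<mu>" using mem_\<mu>_iff[of "act s w" "t ^ D"] w_in_S by simp
next
  assume t: "t ^ D \<in> \<mu>"
  then have "t \<noteq> 0" using zero_notin_\<mu> D by (auto simp: power_0_left)
  obtain s where s: "det s = 1" "act s (form_scale (t ^ D) w) = w"
    using t S_transitive unfolding \<mu>_def by blast
  have "act (s ** mat t) w = w" using s(2) by (simp add: act_act[symmetric] act_scalar[OF w])
  moreover have "det (s ** mat t) = t ^ CARD('m)" using s(1) by (simp add: det_mul det_scalar)
  moreover have "invertible (s ** mat t)" using calculation \<open>t \<noteq> 0\<close> by (simp add: invertible_det_nz)
  ultimately show "t ^ CARD('m) \<in> det ` stabilizer GL act w"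
    by (intro image_eqI[of _ _ "s ** mat t"]) (auto simp: stabilizer_def GL_def)
qed

text \<open>Both sides count the complex numbers \<open>t\<close> with \<open>t\<^sup>D \<in> \<mu>\<close>.\<close>

lemma card_\<mu>: "D * n = CARD('m) * stabilizer_period w"
proof -
  let ?\<Delta> = "det ` stabilizer GL act w"
  have T: "{t. t ^ CARD('m) \<in> ?\<Delta>} = {t. t ^ D \<in> \<mu>}" using stabilizer_det_iff by simp
  have fin: "finite {t. t ^ D \<in> \<mu>}" and card: "card {t. t ^ D \<in> \<mu>} = D * n"
    using card_preimage_power[OF finite_\<mu> zero_notin_\<mu>, of D] D by auto
  have "?\<Delta> \<subseteq> (\<lambda>t. t ^ CARD('m)) ` {t. t ^ CARD('m) \<in> ?\<Delta>}"
  proof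
    fix z assume z: "z \<in> ?\<Delta>"
    obtain t where "t ^ CARD('m) = z" using nth_root_exists[of "CARD('m)" z] by auto
    then show "z \<in> (\<lambda>t. t ^ CARD('m)) ` {t. t ^ CARD('m) \<in> ?\<Delta>}" using z by blast
  qed
  then have "finite ?\<Delta>" using fin finite_surj unfolding T by blast
  moreover have "0 \<notin> ?\<Delta>" by (auto simp: stabilizer_def GL_def invertible_det_nz)
  ultimately have "card {t. t ^ CARD('m) \<in> ?\<Delta>} = CARD('m) * card ?\<Delta>"
    by (intro card_preimage_power) auto
  then show ?thesis using card unfolding T stabilizer_period_def by simp
qed

lemma degree_period_eq: "degree_period D w = real n"
proof -
  have "real D * real n = real CARD('m) * real (stabilizer_period w)"
    using card_\<mu> by (metis of_nat_mult)
  then show ?thesis using D by (simp add: degree_period_def field_simps)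
qed


section \<open>Homogenization and the boundary\<close>

text \<open>On the slice \<open>\<phi> = 1\<close> the parts of a polynomial function whose degrees agree modulo \<open>e\<close>
  can be brought to a common degree by powers of \<open>\<phi>\<close>.\<close>

lemma homogenization:
  assumes q: "q \<in> poly_functions D"
  shows "\<exists>N R. (\<forall>k. R k \<in> poly_functions D) \<and>
    (\<forall>k<e. \<forall>v\<in>Y. \<forall>t. R k (form_scale t v) = t ^ (k + e * N) * R k v) \<and>
    (\<forall>v\<in>Y. \<phi> v = 1 \<longrightarrow>
       (\<forall>z. z ^ e = 1 \<longrightarrow> q (form_scale z v) = (\<Sum>k<e. z ^ k * R k v)))"
proof -
  obtain P N where P: "\<And>j. hom_function D j (P j)" "\<And>v. q v = (\<Sum>j\<le>N. P j v)"
    using poly_functions_graded[OF q] by metis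
  define R where "R = (\<lambda>k v. \<Sum>j | j \<in> {..N} \<and> j mod e = k. P j v * \<phi> v ^ (N - j div e))"
  show ?thesis
  proof (intro exI[of _ N] exI[of _ R] conjI allI ballI impI)
    show "R k \<in> poly_functions D" for k
      unfolding R_def
      by (intro poly_functions_sum poly_functions.mult hom_functions_poly[OF P(1)]
          poly_functions_power \<phi>_poly)
  next
    fix k v t assume k: "k < e" and v: "v \<in> Y"
    have "P j (form_scale t v) * \<phi> (form_scale t v) ^ (N - j div e)
        = t ^ (k + e * N) * (P j v * \<phi> v ^ (N - j div e))" if "j \<le> N" "j mod e = k" for j
    proof -
      have "j div e \<le> N" using that(1) div_le_dividend order_trans by blast
      then have "j + e * (N - j div e) = k + e * N"
        using that(2) mult_div_mod_eq[of e j] by (simp add: diff_mult_distrib2)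
      then have "t ^ j * (t ^ e) ^ (N - j div e) = t ^ (k + e * N)"
        by (simp add: power_mult[symmetric] power_add[symmetric])
      then show ?thesis
        by (simp add: hom_functions_scale[OF P(1) Y_forms[OF v]] \<phi>_scale[OF v] power_mult_distrib mult_ac)
    qed
    then show "R k (form_scale t v) = t ^ (k + e * N) * R k v"
      unfolding R_def sum_distrib_left by (intro sum.cong) auto
  next
    fix v and z :: complex assume v: "v \<in> Y" "\<phi> v = 1" and z: "z ^ e = 1"
    have zmod: "z ^ (j mod e) = z ^ j" for j
    proof -
      have "z ^ j = z ^ (e * (j div e) + j mod e)" by simp
      also have "\<dots> = z ^ (j mod e)" unfolding power_add power_mult z by simp
      finally show ?thesis by simp
    qed
    have "q (form_scale z v) = (\<Sum>j\<le>N. z ^ j * P j v)"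
      by (simp add: P(2) hom_functions_scale[OF P(1) Y_forms[OF v(1)]])
    also have "\<dots> = (\<Sum>k<e. \<Sum>j | j \<in> {..N} \<and> j mod e = k. z ^ j * P j v)"
      using e_pos by (intro sum.group[symmetric]) auto
    also have "\<dots> = (\<Sum>k<e. z ^ k * R k v)"
      unfolding R_def sum_distrib_left v(2) by (intro sum.cong) (auto simp: zmod)
    finally show "q (form_scale z v) = (\<Sum>k<e. z ^ k * R k v)" .
  qed
qed

text \<open>A product of translates, one for each of the closed sets \<open>z S\<close>.\<close>

lemma separation:
  assumes "finite Z" and v: "v \<in> forms D"
    and Z: "\<And>z. z \<in> Z \<Longrightarrow> z \<noteq> 0 \<and> form_scale (1 / z) v \<notin> S"
  obtains q where "q \<in> poly_functions D" "q v \<noteq> 0" "\<And>z u. z \<in> Z \<Longrightarrow> u \<in> S \<Longrightarrow> q (form_scale z u) = 0"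
proof -
  have "\<exists>p. p \<in> poly_functions D \<and> (\<forall>u\<in>S. p u = 0) \<and> p (form_scale (1 / z) v) \<noteq> 0" if "z \<in> Z" for z
  proof -
    have "form_scale (1 / z) v \<notin> S" using Z[OF that] by blast
    then obtain p where "p \<in> poly_functions D" "\<And>u. u \<in> S \<Longrightarrow> p u = 0" "p (form_scale (1 / z) v) \<noteq> 0"
      using S_closed[OF form_scale_in_forms[OF v]] by metis
    then show ?thesis by blast
  qed
  then obtain p where p: "\<And>z. z \<in> Z \<Longrightarrow> p z \<in> poly_functions D"
    "\<And>z u. z \<in> Z \<Longrightarrow> u \<in> S \<Longrightarrow> p z u = 0" "\<And>z. z \<in> Z \<Longrightarrow> p z (form_scale (1 / z) v) \<noteq> 0"
    by metis
  show ?thesis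
  proof (rule that[of "\<lambda>x. \<Prod>z\<in>Z. p z (form_scale (1 / z) x)"])
    show "(\<lambda>x. \<Prod>z\<in>Z. p z (form_scale (1 / z) x)) \<in> poly_functions D"
      using p(1) by (intro poly_functions_prod poly_functions_form_scale)
    show "(\<Prod>z\<in>Z. p z (form_scale (1 / z) v)) \<noteq> 0" using p(3) assms(1) by simp
    show "(\<Prod>z\<in>Z. p z (form_scale (1 / z) (form_scale z' u))) = 0" if "z' \<in> Z" "u \<in> S" for z' u
      using that Z[of z'] p(2)[of z' u] assms(1) by (intro prod_zero) (auto intro!: bexI[of _ z'])
  qed
qed

text \<open>After scaling \<open>\<phi>(v) = 1\<close>. If \<open>v\<close> were in none of the sets \<open>z S\<close> with \<open>z\<^sup>e = 1\<close>, a polynomial function would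
  vanish on their union but not at \<open>v\<close>. Its homogenizations vanish on \<open>S\<close>, hence on the orbit and at \<open>v\<close>, and they add up to
  its value at \<open>v\<close>.\<close>

lemma boundary_iff:
  assumes v: "v \<in> Y" shows "v \<in> orbit GL act w \<longleftrightarrow> \<phi> v \<noteq> 0"
proof
  assume "v \<in> orbit GL act w"
  then show "\<phi> v \<noteq> 0" by (auto simp: orbit_GL_iff \<phi>_orbit)
next
  assume \<phi>v: "\<phi> v \<noteq> 0"
  obtain t where t: "t ^ e = inverse (\<phi> v)" using nth_root_exists[OF e_pos] by blast
  have t0: "t \<noteq> 0" using t \<phi>v e_pos by (auto simp: power_0_left)
  define v1 where "v1 = form_scale t v"
  have v1: "v1 \<in> Y" "\<phi> v1 = 1" using v \<phi>v by (simp_all add: v1_def Y_scale \<phi>_scale t)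
  have "\<exists>z. z ^ e = 1 \<and> form_scale (1 / z) v1 \<in> S"
  proof (rule ccontr)
    assume no: "\<nexists>z. z ^ e = 1 \<and> form_scale (1 / z) v1 \<in> S"
    have fin: "finite {z :: complex. z ^ e = 1}" using e_pos by (rule finite_nth_roots)
    have sep: "z \<noteq> 0 \<and> form_scale (1 / z) v1 \<notin> S" if "z \<in> {z. z ^ e = 1}" for z
      using that no e_pos by (auto simp: power_0_left)
    obtain q where q: "q \<in> poly_functions D" "q v1 \<noteq> 0"
      "\<And>z u. z \<in> {z. z ^ e = 1} \<Longrightarrow> u \<in> S \<Longrightarrow> q (form_scale z u) = 0"
      using separation[OF fin Y_forms[OF v1(1)] sep] by blast
    obtain N R where "\<forall>k. R k \<in> poly_functions D"
      and "\<forall>k<e. \<forall>v\<in>Y. \<forall>t. R k (form_scale t v) = t ^ (k + e * N) * R k v"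
      and "\<forall>v\<in>Y. \<phi> v = 1 \<longrightarrow>
        (\<forall>z. z ^ e = 1 \<longrightarrow> q (form_scale z v) = (\<Sum>k<e. z ^ k * R k v))"
      using homogenization[OF q(1)] by blast
    then have R: "\<And>k. R k \<in> poly_functions D"
      "\<And>k v t. k < e \<Longrightarrow> v \<in> Y \<Longrightarrow> R k (form_scale t v) = t ^ (k + e * N) * R k v"
      "\<And>v z. v \<in> Y \<Longrightarrow> \<phi> v = 1 \<Longrightarrow> z ^ e = 1 \<Longrightarrow> q (form_scale z v) = (\<Sum>k<e. z ^ k * R k v)"
      by simp_all
    have "R k v1 = 0" if k: "k < e" for k
    proof (rule eq_on_Y[OF R(1) poly_functions.const _ v1(1)])
      fix c u assume u: "u \<in> S"
      have "R k u = 0"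
        by (rule coefficients_eq_0[OF _ k])
           (use q(3) u R(3)[OF S_subset_Y[OF u] \<phi>_S[OF u]] in simp)
      then show "R k (form_scale c u) = 0" by (simp add: R(2)[OF k S_subset_Y[OF u]])
    qed
    then have "q v1 = 0" using R(3)[OF v1, of 1] by simp
    then show False using q(2) by simp
  qed
  then obtain z where z: "z ^ e = 1" "form_scale (1 / z) v1 \<in> S" by blast
  have "z \<noteq> 0" using z(1) e_pos by (auto simp: power_0_left)
  then have "v = form_scale (z / t) (form_scale (1 / z) v1)" using t0 by (simp add: v1_def)
  then show "v \<in> orbit GL act w"
    unfolding orbit_GL_iff using z(2) \<open>z \<noteq> 0\<close> t0 by (intro exI[of _ "z / t"] exI[of _ "form_scale (1 / z) v1"]) simp
qed


lemma Y_cancel: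
  assumes "p \<in> poly_functions D" "q \<in> poly_functions D" "r \<in> poly_functions D"
    and "u \<in> Y" "p u \<noteq> 0" and eq: "\<And>v. v \<in> Y \<Longrightarrow> p v * q v = p v * r v" and "v \<in> Y"
  shows "q v = r v"
proof -
  have "p v * (q v - r v) = 0" if "v \<in> Y" for v using eq[OF that] by (simp add: algebra_simps)
  then have "(\<forall>v\<in>Y. p v = 0) \<or> (\<forall>v\<in>Y. q v - r v = 0)"
    using assms(1-3) by (intro Y_integral poly_functions_diff)
  then show ?thesis using assms(4,5,7) by auto
qed

section \<open>A rational function that is an \<open>n\<close>-th power along scaling\<close>

text \<open>If \<open>q\<close> vanishes at \<open>z u\<close> for \<open>z\<^sup>e = 1\<close>, \<open>z \<notin> \<mu>\<close>, its homogenizations \<open>R k\<close> are on \<open>S\<close> the Fourier coefficients of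
  a function on the \<open>e\<close>-th roots of unity that is supported on the subgroup of order \<open>n\<close>. They are
  therefore periodic in \<open>k\<close> with period \<open>n\<close>, and \<open>R (k + n)\<close> over \<open>R k\<close> is the wanted quotient. If \<open>k + n \<ge> e\<close>, a
  factor \<open>\<phi>\<close> repairs the degree.\<close>

lemma exists_rational_semi_invariant:
  "\<exists>A B N. A \<in> poly_functions D \<and> B \<in> poly_functions D \<and> B w \<noteq> 0 \<and>
    (\<forall>t. B (form_scale t w) = t ^ N * B w) \<and>
    (\<forall>c. \<forall>u\<in>S. A (form_scale c u) = c ^ n * B (form_scale c u))"
proof -
  have fin: "finite {z :: complex. z ^ e = 1}" using e_pos by (rule finite_nth_roots)
  have sep: "z \<noteq> 0 \<and> form_scale (1 / z) w \<notin> S" if z: "z \<in> {z. z ^ e = 1} - \<mu>" for z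
  proof
    show "z \<noteq> 0" using z e_pos by (auto simp: power_0_left)
    show "form_scale (1 / z) w \<notin> S"
    proof
      assume "form_scale (1 / z) w \<in> S"
      then have "1 / z \<in> {z. z ^ n = 1}" unfolding \<mu>_eq[symmetric] by (simp add: \<mu>_def)
      then have "z \<in> {z. z ^ n = 1}" by (simp add: power_one_over)
      then show False using z unfolding \<mu>_eq[symmetric] by simp
    qed
  qed
  obtain q where q: "q \<in> poly_functions D" "q w \<noteq> 0"
    "\<And>z u. z \<in> {z. z ^ e = 1} - \<mu> \<Longrightarrow> u \<in> S \<Longrightarrow> q (form_scale z u) = 0"
    using separation[OF finite_Diff[OF fin] w sep] by blast
  obtain N R where "\<forall>k. R k \<in> poly_functions D"
    and "\<forall>k<e. \<forall>v\<in>Y. \<forall>t. R k (form_scale t v) = t ^ (k + e * N) * R k v"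
    and "\<forall>v\<in>Y. \<phi> v = 1 \<longrightarrow>
      (\<forall>z. z ^ e = 1 \<longrightarrow> q (form_scale z v) = (\<Sum>k<e. z ^ k * R k v))"
    using homogenization[OF q(1)] by blast
  then have R: "\<And>k. R k \<in> poly_functions D"
    "\<And>k u t. k < e \<Longrightarrow> u \<in> S \<Longrightarrow> R k (form_scale t u) = t ^ (k + e * N) * R k u"
    "\<And>u z. u \<in> S \<Longrightarrow> z ^ e = 1 \<Longrightarrow> q (form_scale z u) = (\<Sum>k<e. z ^ k * R k u)"
    using S_subset_Y \<phi>_S by simp_all
  have shift: "R ((k + n) mod e) u = R k u" if k: "k < e" and u: "u \<in> S" for k u
  proof -
    define l where "l = (k + n) mod e"
    have l: "l < e" using e_pos by (simp add: l_def)
    have "z ^ (e - l) * (\<Sum>j<e. z ^ j * R j u) = z ^ (e - k) * (\<Sum>j<e. z ^ j * R j u)"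
      if z: "z ^ e = 1" for z
    proof (cases "z \<in> \<mu>")
      case True
      then have zn: "z ^ n = 1" using \<mu>_eq by blast
      have "z ^ (k + n) = z ^ (e * ((k + n) div e) + l)" by (simp add: l_def)
      then have zl: "z ^ l = z ^ k" unfolding power_add power_mult z zn by simp
      have "z ^ (e - l) * z ^ l = z ^ (e - k) * z ^ k"
        using k l z by (simp add: power_add[symmetric])
      moreover have "z \<noteq> 0" using True zero_notin_\<mu> by auto
      ultimately show ?thesis by (simp add: zl)
    next
      case False
      then have "(\<Sum>j<e. z ^ j * R j u) = 0" using q(3)[of z u] R(3)[OF u z] z u by simp
      then show ?thesis by (simp only: mult_zero_right)
    qed
    then have "(\<Sum>z | z ^ e = 1. z ^ (e - l) * (\<Sum>j<e. z ^ j * R j u))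
        = (\<Sum>z | z ^ e = 1. z ^ (e - k) * (\<Sum>j<e. z ^ j * R j u))"
      by (intro sum.cong) auto
    then have "of_nat e * R l u = of_nat e * R k u"
      using extract_coefficient[OF l, of "\<lambda>j. R j u"] extract_coefficient[OF k, of "\<lambda>j. R j u"]
      by simp
    then show ?thesis using e_pos by (simp add: l_def)
  qed
  have "(\<Sum>k<e. R k w) \<noteq> 0" using R(3)[OF w_in_S, of 1] q(2) by simp
  then obtain k where k: "k < e" "R k w \<noteq> 0" by (metis (no_types, lifting) lessThan_iff sum.neutral)
  show ?thesis
  proof (intro exI conjI allI ballI)
    show "(\<lambda>v. R ((k + n) mod e) v * \<phi> v ^ ((k + n) div e)) \<in> poly_functions D"
      by (intro poly_functions.mult poly_functions_power R(1) \<phi>_poly)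
    show "R k \<in> poly_functions D" "R k w \<noteq> 0" by fact+
    show "R k (form_scale t w) = t ^ (k + e * N) * R k w" for t by (rule R(2)[OF k(1) w_in_S])
    fix c :: complex and u assume u: "u \<in> S"
    have "(k + n) mod e + e * N + e * ((k + n) div e) = n + (k + e * N)"
      using mult_div_mod_eq[of e "k + n"] by linarith
    then have "c ^ ((k + n) mod e + e * N) * (c ^ e) ^ ((k + n) div e) = c ^ n * c ^ (k + e * N)"
      by (simp add: power_mult[symmetric] power_add[symmetric] add_ac)
    then show "R ((k + n) mod e) (form_scale c u) * \<phi> (form_scale c u) ^ ((k + n) div e)
        = c ^ n * R k (form_scale c u)"
      using e_pos R(2)[of "(k + n) mod e" u c] R(2)[OF k(1) u, of c] shift[OF k(1) u] u
      by (simp add: \<phi>_orbit mult_ac)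
  qed
qed

lemma power_relation:
  assumes A: "A \<in> poly_functions D" and B: "B \<in> poly_functions D"
    and AB: "\<And>c u. u \<in> S \<Longrightarrow> A (form_scale c u) = c ^ n * B (form_scale c u)" and v: "v \<in> Y"
  shows "A v ^ (e div n) = \<phi> v * B v ^ (e div n)"
proof (rule eq_on_Y[OF poly_functions_power[OF A] poly_functions.mult[OF \<phi>_poly poly_functions_power[OF B]] _ v])
  fix c :: complex and u assume u: "u \<in> S"
  have "(c ^ n) ^ (e div n) = c ^ (n * (e div n))" by (rule power_mult[symmetric])
  then have c: "(c ^ n) ^ (e div n) = c ^ e" by (simp only: dvd_mult_div_cancel[OF n_dvd_e])
  then show "A (form_scale c u) ^ (e div n) = \<phi> (form_scale c u) * B (form_scale c u) ^ (e div n)"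
    by (simp only: AB[OF u] \<phi>_orbit[OF u] power_mult_distrib c)
qed

section \<open>The ideal of the boundary, normality and valuations\<close>

lemma period_quotient_ge_2: "n < e \<Longrightarrow> e div n \<ge> 2"
  using n_dvd_e n_pos by (auto elim!: dvdE)

text \<open>With \<open>e / n = k + 2\<close>, the relation \<open>A\<^bsup>k+2\<^esup> = \<phi> B\<^bsup>k+2\<^esup>\<close> makes \<open>A = A' \<phi>\<close> by the division hypothesis. Then
  \<open>B\<^bsup>k+2\<^esup> = A'\<^bsup>k+2\<^esup> \<phi>\<^bsup>k+1\<^esup>\<close> makes \<open>B = B' \<phi>\<close>, and \<open>A'\<close>, \<open>B'\<close> satisfy the original relation. The degree
  \<open>N\<close> of \<open>B\<close> along the line through \<open>w\<close> has dropped by \<open>e\<close>; if \<open>N < e\<close>, then \<open>B'\<close> would have a pole at the origin.\<close>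

lemma infinite_descent_by_\<phi>:
  assumes "n < e"
    and division: "\<And>p. p \<in> poly_functions D \<Longrightarrow> (\<And>v. v \<in> Y \<Longrightarrow> \<phi> v = 0 \<Longrightarrow> p v = 0) \<Longrightarrow>
      \<exists>r\<in>poly_functions D. \<forall>v\<in>Y. p v = r v * \<phi> v"
  shows "A \<in> poly_functions D \<Longrightarrow> B \<in> poly_functions D \<Longrightarrow> B w \<noteq> 0 \<Longrightarrow>
    (\<And>t. t \<noteq> 0 \<Longrightarrow> B (form_scale t w) = t ^ N * B w) \<Longrightarrow>
    (\<And>v. v \<in> Y \<Longrightarrow> A v ^ (e div n) = \<phi> v * B v ^ (e div n)) \<Longrightarrow> False"
proof (induction N arbitrary: A B rule: less_induct)
  case (less N)
  note A = less.prems(1) and B = less.prems(2) and Bw = less.prems(3) and BN = less.prems(4)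
    and AB = less.prems(5)
  obtain k where k: "e div n = Suc (Suc k)"
    using le_Suc_ex[OF period_quotient_ge_2[OF assms(1)]] by auto
  have w': "w \<in> Y" "\<phi> w \<noteq> 0" using S_subset_Y[OF w_in_S] by (simp_all add: \<phi>_w)
  have "A v = 0" if "v \<in> Y" "\<phi> v = 0" for v
    using AB[OF that(1)] that(2) k by auto
  then obtain A' where A': "A' \<in> poly_functions D" "\<And>v. v \<in> Y \<Longrightarrow> A v = A' v * \<phi> v"
    using division[OF A] by blast
  have B_eq: "A' v ^ Suc (Suc k) * \<phi> v ^ Suc k = B v ^ Suc (Suc k)" if "v \<in> Y" for v
  proof (rule Y_cancel[OF \<phi>_poly _ _ w' _ that])
    show "\<phi> v * (A' v ^ Suc (Suc k) * \<phi> v ^ Suc k) = \<phi> v * B v ^ Suc (Suc k)" if "v \<in> Y" for v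
      using AB[OF that] unfolding k A'(2)[OF that] by (simp add: power_mult_distrib mult_ac)
  qed (intro poly_functions.mult poly_functions_power \<phi>_poly A'(1) B)+
  then have "B v = 0" if "v \<in> Y" "\<phi> v = 0" for v
    using B_eq[OF that(1)] that(2) by auto
  then obtain B' where B': "B' \<in> poly_functions D" "\<And>v. v \<in> Y \<Longrightarrow> B v = B' v * \<phi> v"
    using division[OF B] by blast
  have AB': "A' v ^ (e div n) = \<phi> v * B' v ^ (e div n)" if "v \<in> Y" for v
    unfolding k
  proof (rule Y_cancel[where p = "\<lambda>v. \<phi> v ^ Suc k", OF _ _ _ w'(1) _ _ that])
    show "\<phi> v ^ Suc k * A' v ^ Suc (Suc k) = \<phi> v ^ Suc k * (\<phi> v * B' v ^ Suc (Suc k))" if "v \<in> Y" for v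
      using B_eq[OF that] unfolding B'(2)[OF that] by (simp add: power_mult_distrib mult_ac)
    show "\<phi> w ^ Suc k \<noteq> 0" using w'(2) by simp
  qed (intro poly_functions.mult poly_functions_power \<phi>_poly A'(1) B'(1))+
  have B'w: "B' w = B w" using B'(2)[OF w'(1)] by (simp add: \<phi>_w)
  have B't: "B' (form_scale t w) * t ^ e = t ^ N * B w" if "t \<noteq> 0" for t
    using BN[OF that] B'(2)[OF scale_in_Y[OF that w_in_S]] by (simp add: \<phi>_orbit[OF w_in_S])
  show False
  proof (cases "N < e")
    case True
    obtain P where P: "\<And>t. B' (form_scale t w) = poly P t"
      using poly_functions_along_scaling[OF B'(1) w] by blast
    have "P * Polynomial.monom 1 (e - N) = [:B w:]"
    proof (rule poly_eq_away_0)
      fix t :: complex assume t: "t \<noteq> 0"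
      have "t ^ N * (poly P t * t ^ (e - N)) = t ^ N * B w"
        using B't[OF t] True by (simp add: P mult.left_commute power_add[symmetric])
      then show "poly (P * Polynomial.monom 1 (e - N)) t = poly [:B w:] t"
        using t by (simp add: poly_monom)
    qed
    then have "poly (P * Polynomial.monom 1 (e - N)) 0 = B w" by simp
    then show False using True Bw by (simp add: poly_monom power_0_left)
  next
    case False
    have "B' (form_scale t w) = t ^ (N - e) * B' w" if t: "t \<noteq> 0" for t
    proof -
      have "t ^ N = t ^ (N - e) * t ^ e" using False by (simp add: power_add[symmetric])
      then show ?thesis using B't[OF t] t by (simp add: B'w)
    qed
    then show False
      using less.IH[of "N - e" A' B'] False e_pos A'(1) B'(1) AB' Bw B'w by auto
  qed
qed

text \<open>Translating by \<open>SL\<^sub>m\<close> shows that a quotient \<open>F / H\<close> equal to \<open>A / B\<close> satisfies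
  \<open>F(t u) = t\<^sup>n H(t u)\<close> on the whole orbit, also where \<open>B\<close> vanishes. The part of degree \<open>n\<close> of
  \<open>F\<close> is then an invariant with value \<open>H(0)\<close>, and \<open>n\<close> is smaller than the minimal degree.\<close>

lemma denominator_vanishes_at_0:
  assumes "n < e" and A: "A \<in> poly_functions D" and B: "B \<in> poly_functions D"
    and Bw: "B w \<noteq> 0" and BN: "\<And>t. B (form_scale t w) = t ^ N * B w"
    and AB: "\<And>c u. u \<in> S \<Longrightarrow> A (form_scale c u) = c ^ n * B (form_scale c u)"
    and F: "F \<in> poly_functions D" and H: "H \<in> poly_functions D"
    and eq: "\<And>v. v \<in> Y \<Longrightarrow> A v * H v = F v * B v"
  shows "H (\<lambda>_. 0) = 0"
proof -
  have FH: "F (form_scale t u) = t ^ n * H (form_scale t u)" if u: "u \<in> S" and t: "t \<noteq> 0" for t u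
  proof -
    obtain s where s: "det s = 1" "act s u = w" using S_transitive[OF u] .
    have As: "(\<lambda>v. A (act s v)) \<in> poly_functions D" and Bs: "(\<lambda>v. B (act s v)) \<in> poly_functions D"
      using A B by (simp_all add: poly_functions_act)
    have cross: "A (act s v) * B v = A v * B (act s v)" if "v \<in> Y" for v
    proof (rule eq_on_Y[OF poly_functions.mult[OF As B] poly_functions.mult[OF A Bs] _ that])
      fix c x assume x: "x \<in> S"
      show "A (act s (form_scale c x)) * B (form_scale c x) = A (form_scale c x) * B (act s (form_scale c x))"
        using AB[OF x] AB[OF S_act[OF x s(1)]] by (simp add: act_form_scale)
    qed
    have "F v * B (act s v) = A (act s v) * H v" if "v \<in> Y" for v
    proof (rule Y_cancel[OF B poly_functions.mult[OF F Bs] poly_functions.mult[OF As H]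
          S_subset_Y[OF w_in_S] Bw _ that])
      fix v assume v: "v \<in> Y"
      have "B v * (F v * B (act s v)) = (F v * B v) * B (act s v)" by simp
      also have "\<dots> = (A v * B (act s v)) * H v" by (simp add: eq[OF v, symmetric])
      also have "\<dots> = B v * (A (act s v) * H v)" by (simp add: cross[OF v, symmetric])
      finally show "B v * (F v * B (act s v)) = B v * (A (act s v) * H v)" .
    qed
    from this[OF scale_in_Y[OF t u]]
    have "F (form_scale t u) * B (form_scale t w) = t ^ n * H (form_scale t u) * B (form_scale t w)"
      using AB[OF w_in_S, of t] by (simp add: act_form_scale s(2))
    then show ?thesis using Bw t by (simp add: BN)
  qed
  obtain P M where P: "\<And>j. hom_function D j (P j)" "\<And>j. j > M \<Longrightarrow> P j = (\<lambda>_. 0)"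
    "\<And>v. F v = (\<Sum>j\<le>M. P j v)"
    using poly_functions_graded[OF F] by metis
  have Pn: "P n u = H (\<lambda>_. 0)" if u: "u \<in> S" for u
  proof -
    obtain Q where Q: "\<And>t. H (form_scale t u) = poly Q t"
      using poly_functions_along_scaling[OF H S_forms[OF u]] by blast
    have "(\<Sum>j\<le>M. Polynomial.monom (P j u) j) = Polynomial.monom 1 n * Q"
    proof (rule poly_eq_away_0)
      fix t :: complex assume t: "t \<noteq> 0"
      have "poly (\<Sum>j\<le>M. Polynomial.monom (P j u) j) t = F (form_scale t u)"
        by (simp add: P(3) hom_functions_scale[OF P(1) S_forms[OF u]] poly_sum poly_monom mult.commute)
      then show "poly (\<Sum>j\<le>M. Polynomial.monom (P j u) j) t = poly (Polynomial.monom 1 n * Q) t"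
        by (simp add: FH[OF u t] Q poly_monom)
    qed
    then have "Polynomial.coeff (\<Sum>j\<le>M. Polynomial.monom (P j u) j) n = Polynomial.coeff Q 0"
      by (simp add: coeff_monom_mult)
    moreover have "Polynomial.coeff (\<Sum>j\<le>M. Polynomial.monom (P j u) j) n = P n u"
      using P(2)[of n] by (cases "n \<le> M") (simp_all add: coeff_sum)
    moreover have "Polynomial.coeff Q 0 = H (\<lambda>_. 0)"
      using Q[of 0] by (simp add: form_scale_0 poly_0_coeff_0)
    ultimately show ?thesis by simp
  qed
  have "P n w = 0"
  proof (rule no_invariant_below_e[OF hom_functions_poly[OF P(1)] n_pos assms(1)])
    fix c u assume "u \<in> S"
    then show "P n (form_scale c u) = c ^ n * P n w"
      using hom_functions_scale[OF P(1) S_forms] Pn w_in_S by simp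
  qed
  then show ?thesis using Pn[OF w_in_S] by simp
qed

end

theorem theorem3p10:
  fixes w :: "complex ^ 'm \<Rightarrow> complex" and D :: nat
  assumes "D \<ge> 1"
    and "w \<in> forms D"
    and "w \<noteq> (\<lambda>_. 0)"
    and "polystable D w"
    and "degree_period D w < real (minimal_degree D w)"
  shows "PIdl\<^bsub>coordinate_ring D (orbit_closure D w)\<^esub> (fundamental_invariant D w)
           \<subset> vanishing_ideal D (orbit_closure D w) (orbit_closure D w - orbit GL act w)
       \<and> \<not> normal_variety D (orbit_closure D w)
       \<and> \<not> valuation_ring (coordinate_ring D (orbit_closure D w))"
proof -
  interpret polystable_form D w by unfold_locales (use assms in auto)
  let ?R = "coordinate_ring D Y"
  interpret R: domain ?R by (rule domain_coordinate_ring)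
  have n: "n < e" using assms(5) by (simp add: degree_period_eq)
  obtain A B N where A: "A \<in> poly_functions D" and B: "B \<in> poly_functions D" and Bw: "B w \<noteq> 0"
    and BN: "\<And>t. B (form_scale t w) = t ^ N * B w"
    and AB: "\<And>c u. u \<in> S \<Longrightarrow> A (form_scale c u) = c ^ n * B (form_scale c u)"
    using exists_rational_semi_invariant by blast
  let ?a = "restrict A Y" and ?b = "restrict B Y" and ?\<phi> = "restrict \<phi> Y"
  have w_Y: "w \<in> Y" by (rule S_subset_Y[OF w_in_S])
  have Aw: "A w \<noteq> 0" using AB[OF w_in_S, of 1] Bw by simp
  have a: "?a \<in> carrier ?R - {\<zero>\<^bsub>?R\<^esub>}" and b: "?b \<in> carrier ?R - {\<zero>\<^bsub>?R\<^esub>}"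
    using A B Aw Bw w_Y by (auto simp: restrict_in_coordinate_ring coordinate_ring_simps restrict_eq_iff)
  have no_denominator: "H (\<lambda>_. 0) = 0"
    if "F \<in> poly_functions D" "H \<in> poly_functions D" "\<And>v. v \<in> Y \<Longrightarrow> A v * H v = F v * B v" for F H
    by (rule denominator_vanishes_at_0[OF n A B Bw BN _ that]) (simp_all add: AB)
  have power: "A v ^ (e div n) = \<phi> v * B v ^ (e div n)" if "v \<in> Y" for v
    by (rule power_relation[OF A B _ that]) (simp add: AB)
  have boundary: "v \<in> Y - orbit GL act w \<longleftrightarrow> v \<in> Y \<and> \<phi> v = 0" for v
    using boundary_iff by auto
  have "PIdl\<^bsub>?R\<^esub> ?\<phi> \<subseteq> vanishing_ideal D Y (Y - orbit GL act w)"
  proof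
    fix f assume "f \<in> PIdl\<^bsub>?R\<^esub> ?\<phi>"
    then obtain p where p: "p \<in> poly_functions D" "f = (\<lambda>v\<in>Y. p v * \<phi> v)"
      by (auto simp: cgenideal_def carrier_coordinate_ring coordinate_ring_simps)
    then show "f \<in> vanishing_ideal D Y (Y - orbit GL act w)"
      using boundary unfolding vanishing_ideal_def
      by (auto intro: restrict_in_coordinate_ring poly_functions.mult \<phi>_poly)
  qed
  moreover have "PIdl\<^bsub>?R\<^esub> ?\<phi> \<noteq> vanishing_ideal D Y (Y - orbit GL act w)"
  proof
    assume principal: "PIdl\<^bsub>?R\<^esub> ?\<phi> = vanishing_ideal D Y (Y - orbit GL act w)"
    have "\<exists>r\<in>poly_functions D. \<forall>v\<in>Y. p v = r v * \<phi> v"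
      if p: "p \<in> poly_functions D" "\<And>v. v \<in> Y \<Longrightarrow> \<phi> v = 0 \<Longrightarrow> p v = 0" for p
    proof -
      have "restrict p Y \<in> PIdl\<^bsub>?R\<^esub> ?\<phi>"
        using p boundary unfolding principal vanishing_ideal_def
        by (auto intro: restrict_in_coordinate_ring)
      then obtain r where "r \<in> poly_functions D" "restrict p Y = (\<lambda>v\<in>Y. r v * \<phi> v)"
        by (auto simp: cgenideal_def carrier_coordinate_ring coordinate_ring_simps)
      then show ?thesis unfolding restrict_eq_iff by blast
    qed
    then show False
      by (rule infinite_descent_by_\<phi>[OF n _ A B Bw BN power])
  qed
  ultimately have ideal: "PIdl\<^bsub>?R\<^esub> (fundamental_invariant D w)
      \<subset> vanishing_ideal D Y (Y - orbit GL act w)"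
    unfolding fundamental_invariant_eq by blast
  have not_regular: "H (\<lambda>_. 0) = 0"
    if "fraction ?R ?a ?b = fraction ?R (restrict F Y) (restrict H Y)"
      "F \<in> poly_functions D" "H \<in> poly_functions D" "restrict H Y \<noteq> \<zero>\<^bsub>?R\<^esub>" for F H
  proof -
    have "?a \<otimes>\<^bsub>?R\<^esub> restrict H Y = restrict F Y \<otimes>\<^bsub>?R\<^esub> ?b"
      using R.fraction_eq_iff[of ?a ?b "restrict F Y" "restrict H Y"] that a b
      by (simp add: restrict_in_coordinate_ring)
    then show ?thesis
      using no_denominator[OF that(2,3)] unfolding coordinate_ring_simps restrict_eq_iff by blast
  qed
  have "\<not> normal_variety D Y"
  proof
    assume "normal_variety D Y"
    then have closed: "integrally_closed_in (fraction_field ?R) (local_ring D Y (\<lambda>_. 0))"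
      using zero_in_Y by (auto simp: normal_variety_def)
    have "integral_over (fraction_field ?R) (local_ring D Y (\<lambda>_. 0)) (fraction ?R ?a ?b)"
    proof (rule R.integral_over_root)
      show "?a [^]\<^bsub>?R\<^esub> (e div n) = ?\<phi> \<otimes>\<^bsub>?R\<^esub> ?b [^]\<^bsub>?R\<^esub> (e div n)"
        unfolding coordinate_ring_pow coordinate_ring_simps restrict_eq_iff
        using power by blast
      show "fraction ?R r \<one>\<^bsub>?R\<^esub> \<in> local_ring D Y (\<lambda>_. 0)" if "r \<in> carrier ?R" for r
      proof -
        have "\<one>\<^bsub>?R\<^esub> (\<lambda>_. 0) \<noteq> 0" using zero_in_Y by (simp add: coordinate_ring_one)
        then show ?thesis using that R.one_closed unfolding local_ring_def by blast
      qed
      show "e div n \<ge> 1" using period_quotient_ge_2[OF n] by simp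
    qed (use a b \<phi>_poly in \<open>auto intro: restrict_in_coordinate_ring\<close>)
    moreover have "fraction ?R ?a ?b \<in> carrier (fraction_field ?R)"
      using a b by (intro R.fraction_in_carrier) auto
    ultimately have "fraction ?R ?a ?b \<in> local_ring D Y (\<lambda>_. 0)"
      using closed unfolding integrally_closed_in_def by blast
    then obtain F H where FH: "fraction ?R ?a ?b = fraction ?R (restrict F Y) (restrict H Y)"
      "F \<in> poly_functions D" "H \<in> poly_functions D" "restrict H Y (\<lambda>_. 0) \<noteq> 0"
      by (auto simp: local_ring_def carrier_coordinate_ring)
    have "restrict H Y \<noteq> \<zero>\<^bsub>?R\<^esub>"
      using FH(4) zero_in_Y by (auto simp: coordinate_ring_simps restrict_eq_iff)
    then have "H (\<lambda>_. 0) = 0" using not_regular FH(1-3) by blast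
    then show False using FH(4) zero_in_Y by simp
  qed
  moreover have "\<not> valuation_ring ?R"
  proof
    assume val: "valuation_ring ?R"
    have x: "fraction ?R ?a ?b \<in> carrier (fraction_field ?R) - {\<zero>\<^bsub>fraction_field ?R\<^esub>}"
      using a b R.fraction_in_carrier[of ?a ?b] R.fraction_eq_iff[of ?a ?b "\<zero>\<^bsub>?R\<^esub>" "\<one>\<^bsub>?R\<^esub>"]
      by (simp add: R.zero_fraction_field)
    have inv: "inv\<^bsub>fraction_field ?R\<^esub> fraction ?R ?a ?b = fraction ?R ?b ?a"
      using a b by (rule R.inv_fraction)
    have "fraction ?R ?a ?b \<in> (\<lambda>f. fraction ?R f \<one>\<^bsub>?R\<^esub>) ` carrier ?R \<or>
        inv\<^bsub>fraction_field ?R\<^esub> fraction ?R ?a ?b \<in> (\<lambda>f. fraction ?R f \<one>\<^bsub>?R\<^esub>) ` carrier ?R"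
      using val[unfolded valuation_ring_def Let_def, THEN conjunct2] x by (rule bspec)
    then have "(\<exists>f\<in>carrier ?R. fraction ?R ?a ?b = fraction ?R f \<one>\<^bsub>?R\<^esub>) \<or>
        (\<exists>f\<in>carrier ?R. fraction ?R ?b ?a = fraction ?R f \<one>\<^bsub>?R\<^esub>)"
      unfolding inv image_iff .
    then show False
    proof
      assume "\<exists>f\<in>carrier ?R. fraction ?R ?a ?b = fraction ?R f \<one>\<^bsub>?R\<^esub>"
      then obtain F where "F \<in> poly_functions D"
        "fraction ?R ?a ?b = fraction ?R (restrict F Y) (\<lambda>v\<in>Y. 1)"
        by (auto simp: carrier_coordinate_ring coordinate_ring_one)
      then have "(1 :: complex) = 0"
        using not_regular[of F "\<lambda>_. 1"] poly_functions.const[of 1 D] R.one_not_zero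
        by (simp add: coordinate_ring_one)
      then show False by simp
    next
      assume "\<exists>f\<in>carrier ?R. fraction ?R ?b ?a = fraction ?R f \<one>\<^bsub>?R\<^esub>"
      then obtain F where F: "F \<in> poly_functions D"
        "fraction ?R ?b ?a = fraction ?R (restrict F Y) \<one>\<^bsub>?R\<^esub>"
        by (auto simp: carrier_coordinate_ring)
      then have "?b \<otimes>\<^bsub>?R\<^esub> \<one>\<^bsub>?R\<^esub> = restrict F Y \<otimes>\<^bsub>?R\<^esub> ?a"
        using R.fraction_eq_iff[of ?b ?a "restrict F Y" "\<one>\<^bsub>?R\<^esub>"] a b
        by (simp add: restrict_in_coordinate_ring)
      then have BFA: "\<And>v. v \<in> Y \<Longrightarrow> B v = F v * A v"
        unfolding coordinate_ring_simps restrict_eq_iff by simp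
      obtain P where P: "\<And>t. F (form_scale t w) = poly P t"
        using poly_functions_along_scaling[OF F(1) w] by blast
      have "P * Polynomial.monom 1 n = 1"
      proof (rule poly_eq_away_0)
        fix t :: complex assume t: "t \<noteq> 0"
        have "B (form_scale t w) = F (form_scale t w) * (t ^ n * B (form_scale t w))"
          using BFA[OF scale_in_Y[OF t w_in_S]] AB[OF w_in_S] by simp
        then show "poly (P * Polynomial.monom 1 n) t = poly 1 t"
          using Bw t by (simp add: BN P poly_monom)
      qed
      then have "poly (P * Polynomial.monom 1 n) 0 = 1" by simp
      then show False using n_pos by (simp add: poly_monom power_0_left)
    qed
  qed
  ultimately show ?thesis using ideal by blast
qed

end
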